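(* Let $\kappa^2>0$ and \[ \mathcal{F}(\mathbf{m})=\int_{-\pi}^{\pi}|\partial_t\mathbf{m}(t)|^2\,dt+\kappa^2\int_{-\pi}^{\pi}|\mathbf{m}(t)\times\mathbf{n}(t)|^2\,dt,\qquad\mathbf{m}\in H^1_\sharp([-\pi,\pi],\mathbb{S}^1). \] If $\mathbf{m}_\perp$ is a global minimizer of $\mathcal{F}$ on $H^1_\sharp([-\pi,\pi],\mathbb{S}^1)$, then $\deg\mathbf{m}_\perp\in\{0,1\}$. More precisely, there is a threshold $\kappa_*^2\in[2,3]$ such that: (i) if $\kappa^2>\kappa_*^2$, every global minimizer has degree one; moreover, for every $\kappa^2>0$, $\pm\mathbf{n}$ are the only minimizers of $\mathcal{F}$ in the class $\{\deg\mathbf{m}_\perp=1\}$, with energy $2\pi$; (ii) if $\kappa^2<\kappa_*^2$, every global minimizer has degree zero; moreover, for every $\kappa^2>0$, the minimizers of $\mathcal{F}$ in the class $\{\deg\mathbf{m}_\perp=0\}$ are exactly the maps $\mathbf{m}_\perp(t)=\sin\theta(t)\,\boldsymbol{\tau}(t)+\cos\theta(t)\,\mathbf{n}(t)$ with $\theta(t)=\mathrm{am}_\kappa(-\alpha_\kappa t+b)$, $b\in\mathbb{R}$ (so $\theta$ is strictly decreasing), and their common energy is $\mathcal{F}(\mathbf{m}_\perp)=-2\pi(1+\alpha_\kappa^2)+2\alpha_\kappa E_\kappa$; (iii) $\kappa_*^2$ is the solution of $-2\pi\alpha_\kappa^2+2\alpha_\kappa E_\kappa=4\pi$, numerically $\kappa_*^2\approx2.31742$;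 at $\kappa^2=\kappa_*^2$ both $\pm\mathbf{n}$ and the degree-zero maps of (ii) are global minimizers, with common energy $2\pi$; (iv) for every $\kappa^2>0$, the degree-zero maps of (ii) are locally stable critical points, in the sense that, writing $\mathbf{m}_\perp=\sin\theta\,\boldsymbol{\tau}+\cos\theta\,\mathbf{n}$, the second variation $\int_{-\pi}^{\pi}|\partial_t\phi|^2+\kappa^2\phi^2\cos(2\theta)\,dt$ is nonnegative for all $\phi\in H^1_\sharp([-\pi,\pi],\mathbb{R})$; and for every $\kappa^2>0$, $\pm\mathbf{n}$ are local minimizers of $\mathcal{F}$ in $H^1_\sharp([-\pi,\pi],\mathbb{S}^1)$ (with respect to the $H^1$ topology).
   Context: $H^1_\sharp([-\pi,\pi],\mathbb{S}^1)$ denotes $2\pi$-periodic $H^1$ maps $[-\pi,\pi]\to\mathbb{R}^3$ taking values a.e. in $\mathbb{S}^1\times\{0\}$ (in-plane unit vectors); $\deg$ is the topological degree of such a map viewed as a map $\mathbb{S}^1\to\mathbb{S}^1$. $\mathbf{n}(t)=(\cos t,\sin t,0)$, $\boldsymbol{\tau}(t)=\partial_t\mathbf{n}(t)=(-\sin t,\cos t,0)$. For $\kappa^2>0$, $\alpha_\kappa>0$ is the unique solution of $\frac{1}{2\pi}\int_{-\pi}^{\pi}\frac{dx}{\sqrt{\alpha_\kappa^2+\kappa^2\sin^2x}}=1$. $F_\kappa(\theta)=\int_{-\pi}^{\theta}\frac{dx}{\sqrt{1+(\kappa^2/\alpha_\kappa^2)\sin^2x}}$ for $\theta\in\mathbb{R}$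 (increasing, hence invertible on $\mathbb{R}$), $\mathrm{am}_\kappa=F_\kappa^{-1}$, and $E_\kappa=\int_{-\pi}^{\pi}\sqrt{1+(\kappa^2/\alpha_\kappa^2)\sin^2x}\,dx$. A local minimizer is an $\mathbf{m}$ with $\mathcal{F}(\mathbf{m})\le\mathcal{F}(\mathbf{m}')$ for all $\mathbf{m}'$ in the class sufficiently close to $\mathbf{m}$ in $H^1$. *)

theory Defs
  imports "HOL-Analysis.Analysis"
begin

abbreviation Ipi :: "real set" where "Ipi \<equiv> {-pi..pi}"

(* g is a weak derivative of m on [-pi,pi]: m is (everywhere on [-pi,pi]) the indefinite
   integral of the integrable function g.  In 1D every H^1 function has such an
   (absolutely continuous) representative; we always work with that representative. *)
definition weak_deriv :: "(real \<Rightarrow> 'a::euclidean_space) \<Rightarrow> (real \<Rightarrow> 'a) \<Rightarrow> bool" where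
  "weak_deriv m g \<longleftrightarrow> g absolutely_integrable_on Ipi \<and>
      (\<forall>t\<in>Ipi. m t = m (-pi) + integral {-pi..t} g)"

(* the (a.e. unique) weak derivative *)
definition wderiv :: "(real \<Rightarrow> 'a::euclidean_space) \<Rightarrow> real \<Rightarrow> 'a" where
  "wderiv m = (SOME g. weak_deriv m g)"

definition H1per :: "(real \<Rightarrow> 'a::euclidean_space) \<Rightarrow> bool" where
  "H1per m \<longleftrightarrow> (\<exists>g. weak_deriv m g \<and> (\<lambda>t. norm (g t) ^ 2) integrable_on Ipi)
      \<and> m pi = m (-pi)"

definition H1S1 :: "(real \<Rightarrow> real^3) \<Rightarrow> bool" where
  "H1S1 m \<longleftrightarrow> H1per m \<and> (\<forall>t\<in>Ipi. norm (m t) = 1 \<and> m t $ 3 = 0)"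

definition nvec :: "real \<Rightarrow> real^3" where
  "nvec t = vector [cos t, sin t, 0]"

definition tauvec :: "real \<Rightarrow> real^3" where
  "tauvec t = vector [- sin t, cos t, 0]"

definition deg :: "(real \<Rightarrow> real^3) \<Rightarrow> int" where
  "deg m = (THE d::int. \<exists>\<theta>. continuous_on Ipi \<theta> \<and>
              (\<forall>t\<in>Ipi. m t = vector [cos (\<theta> t), sin (\<theta> t), 0]) \<and>
              \<theta> pi - \<theta> (-pi) = 2 * pi * of_int d)"

(* the energy; k2 stands for kappa^2 *)
definition Fen :: "real \<Rightarrow> (real \<Rightarrow> real^3) \<Rightarrow> real" where
  "Fen k2 m = integral Ipi (\<lambda>t. norm (wderiv m t) ^ 2)
             + k2 * integral Ipi (\<lambda>t. norm (cross3 (m t) (nvec t)) ^ 2)"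

definition H1dist :: "(real \<Rightarrow> 'a::euclidean_space) \<Rightarrow> (real \<Rightarrow> 'a) \<Rightarrow> real" where
  "H1dist m m' = sqrt (integral Ipi (\<lambda>t. norm (m t - m' t) ^ 2)
                      + integral Ipi (\<lambda>t. norm (wderiv m t - wderiv m' t) ^ 2))"

definition global_min :: "real \<Rightarrow> (real \<Rightarrow> real^3) \<Rightarrow> bool" where
  "global_min k2 m \<longleftrightarrow> H1S1 m \<and> (\<forall>m'. H1S1 m' \<longrightarrow> Fen k2 m \<le> Fen k2 m')"

definition min_in_deg :: "real \<Rightarrow> int \<Rightarrow> (real \<Rightarrow> real^3) \<Rightarrow> bool" where
  "min_in_deg k2 d m \<longleftrightarrow> H1S1 m \<and> deg m = d \<and>
      (\<forall>m'. H1S1 m' \<and> deg m' = d \<longrightarrow> Fen k2 m \<le> Fen k2 m')"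

definition local_min :: "real \<Rightarrow> (real \<Rightarrow> real^3) \<Rightarrow> bool" where
  "local_min k2 m \<longleftrightarrow> H1S1 m \<and>
      (\<exists>\<epsilon>>0. \<forall>m'. H1S1 m' \<and> H1dist m' m < \<epsilon> \<longrightarrow> Fen k2 m \<le> Fen k2 m')"

definition alpha :: "real \<Rightarrow> real" where
  "alpha k2 = (THE a. a > 0 \<and>
      (1 / (2 * pi)) * integral Ipi (\<lambda>x. 1 / sqrt (a^2 + k2 * (sin x)^2)) = 1)"

definition Fk :: "real \<Rightarrow> real \<Rightarrow> real" where
  "Fk k2 \<theta> = (let f = (\<lambda>x. 1 / sqrt (1 + (k2 / (alpha k2)^2) * (sin x)^2)) in
      if -pi \<le> \<theta> then integral {-pi..\<theta>} f else - integral {\<theta>..-pi} f)"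

definition am :: "real \<Rightarrow> real \<Rightarrow> real" where
  "am k2 y = (THE \<theta>. Fk k2 \<theta> = y)"

definition Ek :: "real \<Rightarrow> real" where
  "Ek k2 = integral Ipi (\<lambda>x. sqrt (1 + (k2 / (alpha k2)^2) * (sin x)^2))"

definition mzero :: "real \<Rightarrow> real \<Rightarrow> real \<Rightarrow> real^3" where
  "mzero k2 b t = (let \<theta> = am k2 (- alpha k2 * t + b) in
      sin \<theta> *\<^sub>R tauvec t + cos \<theta> *\<^sub>R nvec t)"

end

(* With m = cos \<theta> n + sin \<theta> \<tau>, where \<theta>(\<pi>) - \<theta>(-\<pi>) = 2 \<pi> k and k = deg m - 1,
   the energy is 2 \<pi> + 4 \<pi> k + \<integral> \<theta>'^2 + \<kappa>^2 sin^2 \<theta>.  For k \<ge> 0 it is minimised by constant \<theta>.  For every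
   a > 0 and r(x) = sqrt (a^2 + \<kappa>^2 sin^2 x), completing the square turns the last integral into
   \<integral> (\<theta>' + r(\<theta>))^2 - 2 k \<integral> r - 2 \<pi> a^2, because \<integral> r(\<theta>) \<theta>' only depends on k.  Choosing a = \<alpha>_\<kappa>, the
   square vanishes for k = -1 exactly when \<theta> is an amplitude function, and since \<integral> r > 2 \<pi> by
   Cauchy-Schwarz, the winding numbers k < -1 cost strictly more.  The threshold compares k = 0 with
   k = -1; it is located by bounding \<integral> r through polynomials in cos 2x, whose means are rational. *)

theory Submission
  imports Defs
begin

section \<open>Indefinite integrals of Lebesgue integrable functions\<close>

text \<open>The choice of \<open>a\<close> is forced by the winding. The square vanishes iff
  \<theta>' = - r(\<theta>), and such a solution turns once in time \<integral> 1/r, taken over a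
  period; this must be the interval length 2 pi, which is the equation defining
  \<open>alpha\<close>. With d = k + 1 the terms outside the square collect to -2 pi +
  \<open>excess\<close> + d (4 pi - 2 \<integral> r), which shows how \<integral> r > 2 pi penalises
  negative degrees; degrees zero and one tie when \<open>excess\<close> is 4 pi. The technical
  burden is that competitors have merely Lebesgue integrable derivatives: the null Lagrangian is
  applied to arbitrary maps of the class and the ODE is integrated for a minimizer of unknown
  regularity, so chain rule, lifting and a.e. uniqueness of the weak derivative are proved at that
  level. \<open>alpha\<close> is known only implicitly. The remedy is that \<open>excess\<close> is
  the maximum over b of 2 \<integral> r_b - 2 pi b^2: every b gives a lower bound, and comparing two
  values of \<kappa>^2 with the same b gives monotonicity and continuity.\<close>

text \<open>Setting all functions to zero on \<open>N\<close> turns convergence off \<open>N\<close>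
  into convergence everywhere. Domination survives because \<open>h\<close> is nonnegative, and no
  integral changes.\<close>

lemma dominated_convergence_negligible:
  fixes f :: "nat \<Rightarrow> 'n::euclidean_space \<Rightarrow> 'm::euclidean_space"
  assumes N: "negligible N"
    and f: "\<And>k. f k integrable_on S" and h: "h integrable_on S"
    and le: "\<And>k x. x \<in> S \<Longrightarrow> norm (f k x) \<le> h x"
    and conv: "\<And>x. x \<in> S - N \<Longrightarrow> (\<lambda>k. f k x) \<longlonglongrightarrow> g x"
  shows "g integrable_on S" "(\<lambda>k. integral S (f k)) \<longlonglongrightarrow> integral S g"
proof -
  let ?f = "\<lambda>k x. if x \<in> N then 0 else f k x"
  let ?g = "\<lambda>x. if x \<in> N then 0 else g x"
  have int: "?f k integrable_on S" for k
    by (rule integrable_spike[OF f N]) auto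
  have "h x \<ge> 0" if "x \<in> S" for x
    using le[OF that, of 0] norm_ge_zero order_trans by blast
  then have le': "norm (?f k x) \<le> h x" if "x \<in> S" for k x
    using le that by auto
  have conv': "(\<lambda>k. ?f k x) \<longlonglongrightarrow> ?g x" if "x \<in> S" for x
    using conv that by auto
  note D = dominated_convergence[OF int h le' conv']
  show "g integrable_on S"
    by (rule integrable_spike[OF D(1) N]) auto
  have "integral S (?f k) = integral S (f k)" for k
    by (rule integral_spike[OF N]) auto
  moreover have "integral S ?g = integral S g"
    by (rule integral_spike[OF N]) auto
  ultimately show "(\<lambda>k. integral S (f k)) \<longlonglongrightarrow> integral S g"
    using D(2) by simp
qed

lemma absolutely_integrable_continuous_mult:
  fixes f g :: "real \<Rightarrow> real"
  assumes "continuous_on {a..b} f" "g absolutely_integrable_on {a..b}"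
  shows "(\<lambda>x. f x * g x) absolutely_integrable_on {a..b}"
proof (rule absolutely_integrable_bounded_measurable_product_real)
  show "f \<in> borel_measurable (lebesgue_on {a..b})"
    by (rule continuous_imp_measurable_on_sets_lebesgue[OF assms(1)]) simp
  show "bounded (f ` {a..b})"
    by (intro compact_imp_bounded compact_continuous_image assms) simp
qed (use assms in auto)

lemma chain_rule_integrand_absolutely_integrable:
  fixes f :: "real \<Rightarrow> real"
  assumes "continuous_on UNIV \<phi>" "f absolutely_integrable_on {a..b}"
  shows "(\<lambda>s. \<phi> (c + integral {a..s} f) * f s) absolutely_integrable_on {a..b}"
proof (rule absolutely_integrable_continuous_mult[OF _ assms(2)])
  have "f integrable_on {a..b}"
    using assms(2) absolutely_integrable_on_def by blast
  then have "continuous_on {a..b} (\<lambda>x. c + integral {a..x} f)"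
    by (intro continuous_intros indefinite_integral_continuous_1)
  then show "continuous_on {a..b} (\<lambda>s. \<phi> (c + integral {a..s} f))"
    by (rule continuous_on_compose2[OF assms(1)]) auto
qed

lemma absolutely_integrable_on_initial:
  fixes f :: "real \<Rightarrow> 'a::euclidean_space"
  assumes "f absolutely_integrable_on {a..b}" "t \<in> {a..b}"
  shows "f absolutely_integrable_on {a..t}"
  by (rule absolutely_integrable_on_subinterval[OF assms(1)]) (use assms(2) in auto)

text \<open>The chain rule is closed under dominated limits: the primitives converge pointwise and
  stay within \<integral> h of \<open>c\<close>, so \<phi> is bounded by some \<open>B\<close> on
  their values and \<open>B * h\<close> dominates the integrands.\<close>

lemma chain_rule_integral_limit:
  fixes f :: "nat \<Rightarrow> real \<Rightarrow> real"
  assumes \<Phi>: "\<And>x. (\<Phi> has_real_derivative \<phi> x) (at x)" and \<phi>: "continuous_on UNIV \<phi>"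
    and f: "\<And>k. f k absolutely_integrable_on {a..b}" and h: "h integrable_on {a..b}"
    and le: "\<And>k x. x \<in> {a..b} \<Longrightarrow> norm (f k x) \<le> h x"
    and N: "negligible N"
    and conv: "\<And>x. x \<in> {a..b} - N \<Longrightarrow> (\<lambda>k. f k x) \<longlonglongrightarrow> g x"
    and chain: "\<And>k. integral {a..t} (\<lambda>s. \<phi> (c + integral {a..s} (f k)) * f k s)
                     = \<Phi> (c + integral {a..t} (f k)) - \<Phi> c"
    and t: "t \<in> {a..b}"
  shows "integral {a..t} (\<lambda>s. \<phi> (c + integral {a..s} g) * g s)
         = \<Phi> (c + integral {a..t} g) - \<Phi> c"
proof -
  have sub: "{a..s} \<subseteq> {a..b}" if "s \<in> {a..b}" for s using that by auto
  have fint: "f k integrable_on {a..s}" if "s \<in> {a..b}" for k s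
    using absolutely_integrable_on_initial[OF f that] absolutely_integrable_on_def by blast
  have hint: "h integrable_on {a..s}" if "s \<in> {a..b}" for s
    by (rule integrable_on_subinterval[OF h sub[OF that]])
  have h0: "h x \<ge> 0" if "x \<in> {a..b}" for x
    using le[OF that, of 0] norm_ge_zero order_trans by blast
  have F: "(\<lambda>k. integral {a..s} (f k)) \<longlonglongrightarrow> integral {a..s} g" if "s \<in> {a..b}" for s
    by (rule dominated_convergence_negligible(2)[OF N fint[OF that] hint[OF that]])
       (use le conv sub[OF that] in auto)
  define H where "H = integral {a..b} h"
  have FH: "\<bar>integral {a..s} (f k)\<bar> \<le> H" if "s \<in> {a..b}" for s k
  proof -
    have "norm (integral {a..s} (f k)) \<le> integral {a..s} h"
      by (rule integral_norm_bound_integral[OF fint[OF that] hint[OF that]])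
         (use le sub[OF that] in auto)
    also have "\<dots> \<le> H" unfolding H_def
      by (rule integral_subset_le[OF sub[OF that] hint[OF that] h]) (use h0 in auto)
    finally show ?thesis by simp
  qed
  have "bounded (\<phi> ` {c - H..c + H})"
    by (intro compact_imp_bounded compact_continuous_image continuous_on_subset[OF \<phi>]) auto
  then obtain B where "\<forall>x\<in>{c - H..c + H}. \<bar>\<phi> x\<bar> \<le> B"
    unfolding bounded_iff by auto
  then have B: "\<bar>\<phi> x\<bar> \<le> B" if "x \<in> {c - H..c + H}" for x
    using that by blast
  have "(\<lambda>k. integral {a..t} (\<lambda>s. \<phi> (c + integral {a..s} (f k)) * f k s))
        \<longlonglongrightarrow> integral {a..t} (\<lambda>s. \<phi> (c + integral {a..s} g) * g s)"
  proof (rule dominated_convergence_negligible(2)[OF N])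
    show "(\<lambda>s. \<phi> (c + integral {a..s} (f k)) * f k s) integrable_on {a..t}" for k
      using chain_rule_integrand_absolutely_integrable[OF \<phi> absolutely_integrable_on_initial[OF f t]]
        absolutely_integrable_on_def by blast
    show "(\<lambda>s. B * h s) integrable_on {a..t}"
      using hint[OF t] by (rule integrable_on_mult_right)
    show "norm (\<phi> (c + integral {a..s} (f k)) * f k s) \<le> B * h s" if "s \<in> {a..t}" for k s
    proof -
      have s: "s \<in> {a..b}" using that sub[OF t] by auto
      have "\<bar>\<phi> (c + integral {a..s} (f k))\<bar> \<le> B"
        by (rule B) (use FH[OF s, of k] in auto)
      then show ?thesis unfolding norm_mult
        by (intro mult_mono) (use le[OF s] h0[OF s] in auto)
    qed
    show "(\<lambda>k. \<phi> (c + integral {a..s} (f k)) * f k s)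
          \<longlonglongrightarrow> \<phi> (c + integral {a..s} g) * g s" if "s \<in> {a..t} - N" for s
    proof -
      have s: "s \<in> {a..b}" "s \<notin> N" using that sub[OF t] by auto
      have "isCont \<phi> x" for x using \<phi> by (simp add: continuous_on_eq_continuous_at)
      then show ?thesis
        by (intro tendsto_intros isCont_tendsto_compose[where g=\<phi>] F conv) (use s in auto)
    qed
  qed
  moreover have "(\<lambda>k. \<Phi> (c + integral {a..t} (f k)) - \<Phi> c) \<longlonglongrightarrow> \<Phi> (c + integral {a..t} g) - \<Phi> c"
    by (intro tendsto_intros isCont_tendsto_compose[where g=\<Phi>] F[OF t] DERIV_isCont[OF \<Phi>])
  ultimately show ?thesis
    unfolding chain by (rule LIMSEQ_unique)
qed

lemma absolutely_integrable_imp_continuous_approx: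
  fixes f :: "real \<Rightarrow> real"
  assumes "f absolutely_integrable_on {a..b}"
  obtains N F where "negligible N" "\<And>n. continuous_on UNIV (F n)"
    "\<And>x. x \<in> {a..b} - N \<Longrightarrow> (\<lambda>n. F n x) \<longlonglongrightarrow> f x"
proof -
  have "f \<in> borel_measurable (lebesgue_on {a..b})"
    using assms absolutely_integrable_imp_borel_measurable by fastforce
  then have "f measurable_on {a..b}"
    by (simp add: measurable_on_iff_borel_measurable)
  then obtain N F where NF: "negligible N" "\<And>n. continuous_on UNIV (F n)"
    "\<And>x. x \<notin> N \<Longrightarrow> (\<lambda>n. F n x) \<longlonglongrightarrow> (if x \<in> {a..b} then f x else 0)"
    unfolding measurable_on_def by blast
  show thesis
  proof (rule that[OF NF(1,2)])
    fix x assume "x \<in> {a..b} - N"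
    then show "(\<lambda>n. F n x) \<longlonglongrightarrow> f x"
      using NF(3)[of x] by auto
  qed
qed

lemma tendsto_max_min:
  fixes f :: "nat \<Rightarrow> real"
  assumes "f \<longlonglongrightarrow> l"
  shows "(\<lambda>n. max (- K) (min K (f n))) \<longlonglongrightarrow> max (- K) (min K l)"
  by (intro tendsto_intros assms)

text \<open>Continuous integrands are the classical case; bounded integrands are almost everywhere limits of continuous ones, and general integrands are limits of
  their truncations, in both cases dominatedly.\<close>

lemma chain_rule_integral:
  fixes f :: "real \<Rightarrow> real"
  assumes \<Phi>: "\<And>x. (\<Phi> has_real_derivative \<phi> x) (at x)" and \<phi>: "continuous_on UNIV \<phi>"
    and f: "f absolutely_integrable_on {a..b}" and t: "t \<in> {a..b}"
  shows "integral {a..t} (\<lambda>s. \<phi> (c + integral {a..s} f) * f s)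
         = \<Phi> (c + integral {a..t} f) - \<Phi> c"
proof -
  have cont: "integral {a..t} (\<lambda>s. \<phi> (c + integral {a..s} f) * f s)
         = \<Phi> (c + integral {a..t} f) - \<Phi> c" if "continuous_on {a..b} f" for f
  proof -
    have "((\<lambda>s. \<phi> (c + integral {a..s} f) * f s) has_integral
           \<Phi> (c + integral {a..t} f) - \<Phi> (c + integral {a..a} f)) {a..t}"
    proof (rule fundamental_theorem_of_calculus)
      fix x assume x: "x \<in> {a..t}"
      have "((\<lambda>x. c + integral {a..x} f) has_real_derivative 0 + f x) (at x within {a..b})"
        by (intro DERIV_add DERIV_const integral_has_real_derivative that) (use x t in auto)
      then have "((\<lambda>x. c + integral {a..x} f) has_real_derivative f x) (at x within {a..t})"
        by (auto intro: DERIV_subset) (use t in \<open>auto intro: DERIV_subset\<close>)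
      then have "((\<lambda>x. \<Phi> (c + integral {a..x} f)) has_real_derivative
             \<phi> (c + integral {a..x} f) * f x) (at x within {a..t})"
        by (rule DERIV_chain2[OF \<Phi>])
      then show "((\<lambda>x. \<Phi> (c + integral {a..x} f)) has_vector_derivative
             \<phi> (c + integral {a..x} f) * f x) (at x within {a..t})"
        by (simp add: has_real_derivative_iff_has_vector_derivative)
    qed (use t in auto)
    then show ?thesis by (simp add: integral_unique)
  qed
  define T :: "real \<Rightarrow> real \<Rightarrow> real" where "T K y = max (- K) (min K y)" for K y
  obtain N F where NF: "negligible N" "\<And>n. continuous_on UNIV (F n)"
    "\<And>x. x \<in> {a..b} - N \<Longrightarrow> (\<lambda>n. F n x) \<longlonglongrightarrow> f x"
    using absolutely_integrable_imp_continuous_approx[OF f] by blast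
  have contT: "continuous_on {a..b} (\<lambda>x. T K (F n x))" for K n
    unfolding T_def by (intro continuous_intros continuous_on_subset[OF NF(2)]) auto
  have Tf: "(\<lambda>x. T K (f x)) absolutely_integrable_on {a..b}" for K
    unfolding T_def
    by (intro absolutely_integrable_max_1 absolutely_integrable_min_1 f) auto
  have trunc: "integral {a..t} (\<lambda>s. \<phi> (c + integral {a..s} (\<lambda>x. T K (f x))) * T K (f s))
         = \<Phi> (c + integral {a..t} (\<lambda>x. T K (f x))) - \<Phi> c" for K
  proof (rule chain_rule_integral_limit[OF \<Phi> \<phi> _ _ _ NF(1) _ _ t])
    show "(\<lambda>x. T K (F n x)) absolutely_integrable_on {a..b}" for n
      by (rule absolutely_integrable_continuous_real[OF contT])
    show "(\<lambda>x. \<bar>K\<bar>) integrable_on {a..b}"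
      by (rule integrable_const_ivl)
    show "(\<lambda>n. T K (F n x)) \<longlonglongrightarrow> T K (f x)" if "x \<in> {a..b} - N" for x
      unfolding T_def by (intro tendsto_max_min NF(3) that)
    show "norm (T K (F n x)) \<le> \<bar>K\<bar>" for n x unfolding T_def by auto
  qed (rule cont[OF contT])
  have fint: "f integrable_on {a..b}" "(\<lambda>x. \<bar>f x\<bar>) integrable_on {a..b}"
    using f by (auto simp: absolutely_integrable_on_def)
  show ?thesis
  proof (rule chain_rule_integral_limit[OF \<Phi> \<phi> Tf fint(2) _ negligible_empty _ trunc t])
    show "norm (T (real k) (f x)) \<le> \<bar>f x\<bar>" for k x unfolding T_def by auto
    show "(\<lambda>k. T (real k) (f x)) \<longlonglongrightarrow> f x" for x
    proof (rule tendsto_eventually)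
      obtain M :: nat where "\<bar>f x\<bar> \<le> real M" using real_arch_simple by blast
      then show "\<forall>\<^sub>F k in sequentially. T (real k) (f x) = f x"
        unfolding eventually_sequentially T_def by (intro exI[of _ M]) auto
    qed
  qed
qed

section \<open>Calculus of weak derivatives\<close>

lemma integral_nonneg_eq_0_imp_negligible:
  fixes f :: "real \<Rightarrow> real"
  assumes f: "f absolutely_integrable_on S" and S: "S \<in> sets lebesgue"
    and nonneg: "\<And>x. x \<in> S \<Longrightarrow> f x \<ge> 0" and "integral S f = 0"
  obtains N where "negligible N" "\<And>x. x \<in> S - N \<Longrightarrow> f x = 0"
proof -
  have i: "integrable (lebesgue_on S) f"
    by (rule absolutely_integrable_imp_integrable[OF f S])
  have "integral\<^sup>L (lebesgue_on S) f = 0"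
    using lebesgue_integral_eq_integral[OF i S] assms(4) by simp
  moreover have "AE x in lebesgue_on S. 0 \<le> f x"
    using nonneg S by (simp add: AE_restrict_space_iff)
  ultimately have "AE x in lebesgue_on S. f x = 0"
    using integral_nonneg_eq_0_iff_AE[OF i] by blast
  then have "AE x in lebesgue. x \<in> S \<longrightarrow> f x = 0"
    using S by (simp add: AE_restrict_space_iff)
  then obtain N where "N \<in> null_sets lebesgue" "{x. \<not> (x \<in> S \<longrightarrow> f x = 0)} \<subseteq> N"
    by (auto simp: eventually_ae_filter)
  then show thesis
    by (intro that[of N]) (auto simp: negligible_iff_null_sets)
qed

lemma weak_derivD:
  assumes "weak_deriv m g"
  shows "g absolutely_integrable_on Ipi" "g integrable_on Ipi"
    and "\<And>t. t \<in> Ipi \<Longrightarrow> m t = m (- pi) + integral {-pi..t} g"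
    and "\<And>t. t \<in> Ipi \<Longrightarrow> g integrable_on {-pi..t}"
proof -
  show g: "g absolutely_integrable_on Ipi"
    using assms unfolding weak_deriv_def by simp
  then show "g integrable_on Ipi"
    unfolding absolutely_integrable_on_def by simp
  show "m t = m (- pi) + integral {-pi..t} g" if "t \<in> Ipi" for t
    using assms that unfolding weak_deriv_def by blast
  show "g integrable_on {-pi..t}" if "t \<in> Ipi" for t
    using absolutely_integrable_on_initial[OF g that] unfolding absolutely_integrable_on_def by simp
qed

lemma weak_deriv_integral:
  assumes "weak_deriv m g"
  shows "integral Ipi g = m pi - m (- pi)"
proof -
  have "m pi = m (- pi) + integral Ipi g"
    by (rule weak_derivD(3)[OF assms]) simp
  then show ?thesis by (simp only: add_diff_cancel_left')
qed

lemma weak_deriv_continuous: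
  assumes "weak_deriv m g"
  shows "continuous_on Ipi m"
proof -
  have "continuous_on Ipi (\<lambda>t. m (- pi) + integral {-pi..t} g)"
    by (intro continuous_intros indefinite_integral_continuous_1 weak_derivD(2)[OF assms])
  moreover have "continuous_on Ipi m \<longleftrightarrow> continuous_on Ipi (\<lambda>t. m (- pi) + integral {-pi..t} g)"
    by (rule continuous_on_cong[OF refl]) (rule weak_derivD(3)[OF assms])
  ultimately show ?thesis by simp
qed

lemma weak_deriv_cong:
  assumes "weak_deriv m g" "\<And>t. t \<in> Ipi \<Longrightarrow> m' t = m t"
    and N: "negligible N" and g: "\<And>t. t \<in> Ipi - N \<Longrightarrow> g' t = g t"
  shows "weak_deriv m' g'"
proof -
  have eq: "integral {-pi..t} g' = integral {-pi..t} g" if "t \<in> Ipi" for t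
    by (rule integral_spike[OF N]) (use g that in auto)
  have "m' (- pi) = m (- pi)" by (rule assms(2)) simp
  then have "m' t = m' (- pi) + integral {-pi..t} g'" if "t \<in> Ipi" for t
    using weak_derivD(3)[OF assms(1) that] assms(2)[OF that] eq[OF that] by simp
  moreover have "g' absolutely_integrable_on Ipi"
    by (rule absolutely_integrable_spike[OF weak_derivD(1)[OF assms(1)] N g])
  ultimately show ?thesis
    unfolding weak_deriv_def by (intro conjI ballI)
qed

lemma weak_deriv_add:
  assumes "weak_deriv F f" "weak_deriv G g"
  shows "weak_deriv (\<lambda>t. F t + G t) (\<lambda>t. f t + g t)"
  unfolding weak_deriv_def
proof (intro conjI ballI)
  show "(\<lambda>t. f t + g t) absolutely_integrable_on Ipi"
    using weak_derivD(1) assms by (intro set_integral_add(1)) auto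
  fix t assume t: "t \<in> Ipi"
  show "F t + G t = F (- pi) + G (- pi) + integral {-pi..t} (\<lambda>t. f t + g t)"
    using weak_derivD(3)[OF assms(1) t] weak_derivD(3)[OF assms(2) t]
      integral_add[OF weak_derivD(4)[OF assms(1) t] weak_derivD(4)[OF assms(2) t]]
    by (simp add: algebra_simps)
qed

lemma weak_deriv_linear:
  assumes "weak_deriv F f" "bounded_linear h"
  shows "weak_deriv (\<lambda>t. h (F t)) (\<lambda>t. h (f t))"
  unfolding weak_deriv_def
proof (intro conjI ballI)
  show "(\<lambda>t. h (f t)) absolutely_integrable_on Ipi"
    using absolutely_integrable_linear[OF weak_derivD(1)[OF assms(1)] assms(2)] by (simp add: o_def)
  fix t assume t: "t \<in> Ipi"
  show "h (F t) = h (F (- pi)) + integral {-pi..t} (\<lambda>t. h (f t))"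
    using weak_derivD(3)[OF assms(1) t] integral_linear[OF weak_derivD(4)[OF assms(1) t] assms(2)]
    by (simp add: o_def bounded_linear.linear[OF assms(2)] linear_add)
qed

lemma weak_deriv_cmult:
  fixes F :: "real \<Rightarrow> real"
  shows "weak_deriv F f \<Longrightarrow> weak_deriv (\<lambda>t. c * F t) (\<lambda>t. c * f t)"
  by (rule weak_deriv_linear[OF _ bounded_linear_mult_right])

lemma weak_deriv_minus: "weak_deriv F f \<Longrightarrow> weak_deriv (\<lambda>t. - F t) (\<lambda>t. - f t)"
  by (rule weak_deriv_linear[OF _ bounded_linear_minus[OF bounded_linear_ident]])

lemma weak_deriv_diff:
  assumes "weak_deriv F f" "weak_deriv G g"
  shows "weak_deriv (\<lambda>t. F t - G t) (\<lambda>t. f t - g t)"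
  using weak_deriv_add[OF assms(1) weak_deriv_minus[OF assms(2)]] by simp

lemma weak_deriv_continuous_integrand:
  fixes F :: "real \<Rightarrow> 'a::euclidean_space"
  assumes "\<And>t. t \<in> Ipi \<Longrightarrow> (F has_vector_derivative f t) (at t)"
    and "continuous_on Ipi f"
  shows "weak_deriv F f"
  unfolding weak_deriv_def
proof (intro conjI ballI)
  show "f absolutely_integrable_on Ipi"
    using absolutely_integrable_continuous[of "-pi" pi f] assms(2) by simp
  fix t assume t: "t \<in> Ipi"
  have "(f has_integral (F t - F (- pi))) {-pi..t}"
    by (rule fundamental_theorem_of_calculus)
       (use t in \<open>auto intro!: has_vector_derivative_at_within assms(1)\<close>)
  then show "F t = F (- pi) + integral {-pi..t} f"
    by (simp add: integral_unique)
qed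

lemma weak_deriv_ident: "weak_deriv (\<lambda>t::real. t) (\<lambda>_. 1)"
  by (rule weak_deriv_continuous_integrand) (auto intro: has_vector_derivative_id)

lemma weak_deriv_const: "weak_deriv (\<lambda>t. c) (\<lambda>_. 0)"
  by (rule weak_deriv_continuous_integrand) auto

lemma weak_deriv_compose:
  assumes F: "weak_deriv F f" and \<Phi>: "\<And>x. (\<Phi> has_real_derivative \<phi> x) (at x)"
    and \<phi>: "continuous_on UNIV \<phi>"
  shows "weak_deriv (\<lambda>t. \<Phi> (F t)) (\<lambda>t. \<phi> (F t) * f t)"
  unfolding weak_deriv_def
proof (intro conjI ballI)
  show "(\<lambda>t. \<phi> (F t) * f t) absolutely_integrable_on Ipi"
    by (intro absolutely_integrable_continuous_mult weak_derivD(1)[OF F]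
        continuous_on_compose2[OF \<phi> weak_deriv_continuous[OF F]]) auto
  fix t assume t: "t \<in> Ipi"
  have "integral {-pi..t} (\<lambda>t. \<phi> (F t) * f t)
     = integral {-pi..t} (\<lambda>s. \<phi> (F (- pi) + integral {-pi..s} f) * f s)"
  proof (rule integral_cong)
    fix s assume "s \<in> {-pi..t}"
    then have s: "s \<in> Ipi" using t by auto
    show "\<phi> (F s) * f s = \<phi> (F (- pi) + integral {-pi..s} f) * f s"
      by (subst weak_derivD(3)[OF F s]) (rule refl)
  qed
  also have "\<dots> = \<Phi> (F (- pi) + integral {-pi..t} f) - \<Phi> (F (- pi))"
    by (rule chain_rule_integral[OF \<Phi> \<phi> weak_derivD(1)[OF F] t])
  also have "\<dots> = \<Phi> (F t) - \<Phi> (F (- pi))"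
    using weak_derivD(3)[OF F t] by simp
  finally show "\<Phi> (F t) = \<Phi> (F (- pi)) + integral {-pi..t} (\<lambda>t. \<phi> (F t) * f t)"
    by simp
qed

text \<open>Polarisation, F G = ((F + G)^2 - (F - G)^2) / 4, reduces the product rule to the chain
  rule for squaring.\<close>

lemma weak_deriv_mult:
  fixes F G :: "real \<Rightarrow> real"
  assumes F: "weak_deriv F f" and G: "weak_deriv G g"
  shows "weak_deriv (\<lambda>t. F t * G t) (\<lambda>t. f t * G t + F t * g t)"
proof -
  have sq: "weak_deriv (\<lambda>t. (H t)\<^sup>2) (\<lambda>t. (2 * H t) * h t)" if "weak_deriv H h" for H h :: "real \<Rightarrow> real"
    by (rule weak_deriv_compose[OF that]) (auto intro!: derivative_eq_intros continuous_intros)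
  have "weak_deriv (\<lambda>t. 1/4 * ((F t + G t)\<^sup>2 - (F t - G t)\<^sup>2))
     (\<lambda>t. 1/4 * ((2 * (F t + G t)) * (f t + g t) - (2 * (F t - G t)) * (f t - g t)))"
    by (intro weak_deriv_cmult weak_deriv_diff weak_deriv_add sq F G)
  then show ?thesis
    by (rule weak_deriv_cong[OF _ _ negligible_empty]) (auto simp: power2_eq_square field_simps)
qed

text \<open>The zero function has no other weak derivative: if $d$ is one, the product rule makes $d$
  orthogonal to polynomials, hence to continuous functions, hence to its own truncation.\<close>

lemma weak_deriv_zero_imp_negligible:
  fixes d :: "real \<Rightarrow> real"
  assumes d: "weak_deriv (\<lambda>_. 0) d"
  obtains N where "negligible N" "\<And>t. t \<in> Ipi - N \<Longrightarrow> d t = 0"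
proof -
  note dabs = weak_derivD(1)[OF d]
  have dint: "(\<lambda>t. \<bar>d t\<bar>) integrable_on Ipi"
    using dabs by (auto simp: absolutely_integrable_on_def)
  have poly0: "integral Ipi (\<lambda>t. p t * d t) = 0" if pp: "real_polynomial_function p" for p
  proof -
    obtain p' where p': "real_polynomial_function p'" "\<And>x. (p has_real_derivative p' x) (at x)"
      using has_real_derivative_polynomial_function[OF pp] by blast
    have "weak_deriv p p'"
      by (rule weak_deriv_continuous_integrand)
         (use p' in \<open>auto simp: has_real_derivative_iff_has_vector_derivative real_polynomial_function_eq
            intro!: continuous_on_polymonial_function\<close>)
    \<comment> \<open>The product 0 * p has weak derivative d p + 0 * p', and its boundary values
      agree, so d p integrates to zero.\<close>
    from weak_deriv_integral[OF weak_deriv_mult[OF d this]]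
    show ?thesis by (simp add: mult.commute)
  qed
  have cont0: "integral Ipi (\<lambda>t. c t * d t) = 0" if c: "continuous_on Ipi c" for c
  proof -
    have *: "\<bar>integral Ipi (\<lambda>t. c t * d t)\<bar> \<le> e * integral Ipi (\<lambda>t. \<bar>d t\<bar>)" if e: "e > 0" for e
    proof -
      obtain p where p: "real_polynomial_function p" "\<And>x. x \<in> Ipi \<Longrightarrow> \<bar>c x - p x\<bar> < e"
        using Stone_Weierstrass_real_polynomial_function[OF _ c e] by blast
      have pc: "continuous_on Ipi p"
        using p(1) by (simp add: real_polynomial_function_eq continuous_on_polymonial_function)
      have i: "(\<lambda>t. c t * d t) integrable_on Ipi" "(\<lambda>t. p t * d t) integrable_on Ipi"
        using absolutely_integrable_continuous_mult[OF c dabs]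
          absolutely_integrable_continuous_mult[OF pc dabs]
        by (auto simp: absolutely_integrable_on_def)
      have "integral Ipi (\<lambda>t. c t * d t) = integral Ipi (\<lambda>t. c t * d t - p t * d t)"
        using integral_diff[OF i] poly0[OF p(1)] by simp
      also have "norm \<dots> \<le> integral Ipi (\<lambda>t. e * \<bar>d t\<bar>)"
      proof (rule integral_norm_bound_integral)
        show "norm (c t * d t - p t * d t) \<le> e * \<bar>d t\<bar>" if "t \<in> Ipi" for t
          using p(2)[OF that] by (simp add: abs_mult left_diff_distrib[symmetric] mult_right_mono)
      qed (use integrable_diff[OF i] integrable_on_mult_right[OF dint] in auto)
      finally show ?thesis by simp
    qed
    \<comment> \<open>Adding 1 keeps the factor positive even if |d| has integral zero, so that
      \<open>X / (2 * Y)\<close> below is an admissible accuracy.\<close>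
    have le: "\<bar>integral Ipi (\<lambda>t. c t * d t)\<bar> \<le> e * (integral Ipi (\<lambda>t. \<bar>d t\<bar>) + 1)" if "e > 0" for e
      by (rule order_trans[OF *[OF that]]) (use that in \<open>simp add: distrib_left\<close>)
    define X Y where "X = \<bar>integral Ipi (\<lambda>t. c t * d t)\<bar>" and "Y = integral Ipi (\<lambda>t. \<bar>d t\<bar>) + 1"
    have Y: "Y > 0"
      using integral_nonneg[OF dint] by (simp add: Y_def)
    have "\<not> X > 0"
    proof
      assume "X > 0"
      with Y have "X \<le> X / (2 * Y) * Y"
        unfolding X_def Y_def by (intro le) simp
      then show False using Y \<open>X > 0\<close> by simp
    qed
    then show "integral Ipi (\<lambda>t. c t * d t) = 0"
      by (simp add: X_def)
  qed
  obtain N F where NF: "negligible N" "\<And>n. continuous_on UNIV (F n)"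
    "\<And>x. x \<in> Ipi - N \<Longrightarrow> (\<lambda>n. F n x) \<longlonglongrightarrow> d x"
    using absolutely_integrable_imp_continuous_approx[OF dabs] by blast
  \<comment> \<open>Truncating at level 1 makes the test function bounded, so its product with the
    merely integrable \<open>d\<close> is integrable; \<open>T y * y\<close> is nonnegative and
    vanishes only at zero.\<close>
  define T :: "real \<Rightarrow> real" where "T y = max (- 1) (min 1 y)" for y
  have Tc: "continuous_on Ipi (\<lambda>x. T (F n x))" for n
    unfolding T_def by (intro continuous_intros continuous_on_subset[OF NF(2)]) auto
  have "(\<lambda>n. integral Ipi (\<lambda>t. T (F n t) * d t)) \<longlonglongrightarrow> integral Ipi (\<lambda>t. T (d t) * d t)"
  proof (rule dominated_convergence_negligible(2)[OF NF(1) _ dint])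
    show "(\<lambda>t. T (F n t) * d t) integrable_on Ipi" for n
      using absolutely_integrable_continuous_mult[OF Tc dabs] by (auto simp: absolutely_integrable_on_def)
    show "norm (T (F n t) * d t) \<le> \<bar>d t\<bar>" for n t
      unfolding norm_mult T_def using mult_right_mono[of _ 1 "\<bar>d t\<bar>"] by auto
    show "(\<lambda>n. T (F n t) * d t) \<longlonglongrightarrow> T (d t) * d t" if "t \<in> Ipi - N" for t
      unfolding T_def by (intro tendsto_intros tendsto_max_min NF(3) that)
  qed
  then have 0: "integral Ipi (\<lambda>t. T (d t) * d t) = 0"
    using cont0[OF Tc] by (simp add: LIMSEQ_const_iff)
  have Td: "(\<lambda>t. T (d t) * d t) absolutely_integrable_on Ipi"
  proof (rule absolutely_integrable_bounded_measurable_product_real[OF _ _ _ dabs])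
    have "(\<lambda>t. T (d t)) absolutely_integrable_on Ipi"
      unfolding T_def by (intro absolutely_integrable_max_1 absolutely_integrable_min_1 dabs) auto
    then show "(\<lambda>t. T (d t)) \<in> borel_measurable (lebesgue_on Ipi)"
      using absolutely_integrable_imp_borel_measurable by fastforce
    show "bounded ((\<lambda>t. T (d t)) ` Ipi)"
      unfolding bounded_iff T_def by (intro exI[of _ 1]) auto
  qed auto
  have nn: "T y * y \<ge> 0" for y
    unfolding T_def by (cases "y \<ge> 0") (auto simp: max_def min_def mult_nonpos_nonpos)
  obtain M where M: "negligible M" "\<And>t. t \<in> Ipi - M \<Longrightarrow> T (d t) * d t = 0"
    using integral_nonneg_eq_0_imp_negligible[OF Td _ _ 0] nn by auto
  show thesis
  proof (rule that[OF M(1)])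
    have "y = 0" if "T y * y = 0" for y
      using that by (auto simp: T_def max_def min_def split: if_splits)
    then show "d t = 0" if "t \<in> Ipi - M" for t
      using M(2)[OF that] by blast
  qed
qed

lemma weak_deriv_unique:
  fixes F :: "real \<Rightarrow> real"
  assumes "weak_deriv F f" "weak_deriv F g"
  obtains N where "negligible N" "\<And>t. t \<in> Ipi - N \<Longrightarrow> f t = g t"
proof -
  have "weak_deriv (\<lambda>_. 0::real) (\<lambda>t. f t - g t)"
    using weak_deriv_diff[OF assms] by simp
  then obtain N where "negligible N" "\<And>t. t \<in> Ipi - N \<Longrightarrow> f t - g t = 0"
    using weak_deriv_zero_imp_negligible by blast
  then show thesis by (intro that[of N]) auto
qed

section \<open>Vector-valued weak derivatives, componentwise\<close>

lemma weak_deriv_cart_iff: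
  fixes m :: "real \<Rightarrow> real^'n"
  shows "weak_deriv m g \<longleftrightarrow> (\<forall>i. weak_deriv (\<lambda>t. m t $ i) (\<lambda>t. g t $ i))"
proof
  show "\<forall>i. weak_deriv (\<lambda>t. m t $ i) (\<lambda>t. g t $ i)" if "weak_deriv m g"
    using weak_deriv_linear[OF that bounded_linear_vec_nth] by blast
next
  assume *: "\<forall>i. weak_deriv (\<lambda>t. m t $ i) (\<lambda>t. g t $ i)"
  have g: "g absolutely_integrable_on Ipi"
    using * weak_derivD(1) by (subst absolutely_integrable_on_iff_component) auto
  show "weak_deriv m g"
    unfolding weak_deriv_def
  proof (intro conjI ballI g)
    fix t assume t: "t \<in> Ipi"
    have "g integrable_on {-pi..t}"
      using absolutely_integrable_on_initial[OF g t] absolutely_integrable_on_def by blast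
    then show "m t = m (- pi) + integral {-pi..t} g"
      using weak_derivD(3)[OF _ t, of "\<lambda>t. m t $ i" "\<lambda>t. g t $ i" for i] * by (simp add: vec_eq_iff)
  qed
qed

lemma weak_deriv_unique_cart:
  fixes F :: "real \<Rightarrow> real^'n"
  assumes "weak_deriv F f" "weak_deriv F g"
  obtains N where "negligible N" "\<And>t. t \<in> Ipi - N \<Longrightarrow> f t = g t"
proof -
  have "\<exists>N. negligible N \<and> (\<forall>t\<in>Ipi - N. f t $ i = g t $ i)" for i
  proof -
    have "weak_deriv (\<lambda>t. F t $ i) (\<lambda>t. f t $ i)" "weak_deriv (\<lambda>t. F t $ i) (\<lambda>t. g t $ i)"
      using assms by (simp_all add: weak_deriv_cart_iff)
    from weak_deriv_unique[OF this] show ?thesis by metis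
  qed
  then obtain N where N: "\<And>i. negligible (N i)" "\<And>i t. t \<in> Ipi - N i \<Longrightarrow> f t $ i = g t $ i"
    by metis
  show thesis
    by (rule that[of "\<Union>i. N i"]) (use N in \<open>auto simp: vec_eq_iff intro!: negligible_Union\<close>)
qed

text \<open>\<open>wderiv\<close> is an arbitrary choice among the weak derivatives; everything
  later rests on this fact and on uniqueness almost everywhere.\<close>

lemma weak_deriv_wderiv: "weak_deriv m g \<Longrightarrow> weak_deriv m (wderiv m)"
  unfolding wderiv_def by (rule someI[of "weak_deriv m"])

section \<open>Phases of circle-valued maps\<close>

lemma norm_sq_real3: "(norm (v::real^3))\<^sup>2 = (v$1)\<^sup>2 + (v$2)\<^sup>2 + (v$3)\<^sup>2"
  by (simp only: power2_norm_eq_inner) (simp add: inner_vec_def sum_3 power2_eq_square)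

lemma nvec_nth [simp]: "nvec t $ 1 = cos t" "nvec t $ 2 = sin t" "nvec t $ 3 = 0"
  by (simp_all add: nvec_def)

lemma tauvec_nth [simp]: "tauvec t $ 1 = - sin t" "tauvec t $ 2 = cos t" "tauvec t $ 3 = 0"
  by (simp_all add: tauvec_def)

lemma norm_nvec [simp]: "norm (nvec t) = 1"
proof -
  have "(norm (nvec t))\<^sup>2 = 1\<^sup>2" by (simp add: norm_sq_real3)
  then show ?thesis by (simp only: power2_eq_iff_nonneg norm_ge_zero zero_le_one)
qed

lemma norm_tauvec [simp]: "norm (tauvec t) = 1"
proof -
  have "(norm (tauvec t))\<^sup>2 = 1\<^sup>2" by (simp add: norm_sq_real3)
  then show ?thesis by (simp only: power2_eq_iff_nonneg norm_ge_zero zero_le_one)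
qed

lemma cart3_eqI: "v$1 = w$1 \<Longrightarrow> v$2 = w$2 \<Longrightarrow> v$3 = w$3 \<Longrightarrow> v = (w::real^3)"
  by (simp add: vec_eq_iff forall_3)

lemma nvec_add: "nvec (t + \<theta>) = sin \<theta> *\<^sub>R tauvec t + cos \<theta> *\<^sub>R nvec t"
  by (rule cart3_eqI) (simp_all add: cos_add sin_add)

text \<open>The in-plane map $m = \cos\theta\,n + \sin\theta\,\tau$ with weakly differentiable phase
  $\theta$; the integer is the winding of $m$ relative to the frame $(n, \tau)$.\<close>

definition phase :: "(real \<Rightarrow> real^3) \<Rightarrow> (real \<Rightarrow> real) \<Rightarrow> (real \<Rightarrow> real) \<Rightarrow> int \<Rightarrow> bool" where
  "phase m \<theta> g k \<longleftrightarrow> weak_deriv \<theta> g \<and> (\<lambda>t. (g t)\<^sup>2) integrable_on Ipi \<and>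
     (\<forall>t\<in>Ipi. m t = nvec (t + \<theta> t)) \<and> \<theta> pi - \<theta> (- pi) = 2 * pi * of_int k"

lemma phaseD:
  assumes "phase m \<theta> g k"
  shows "weak_deriv \<theta> g" "(\<lambda>t. (g t)\<^sup>2) integrable_on Ipi"
    "\<And>t. t \<in> Ipi \<Longrightarrow> m t = nvec (t + \<theta> t)" "\<theta> pi - \<theta> (- pi) = 2 * pi * of_int k"
  using assms unfolding phase_def by simp_all

lemma phase_lift:
  assumes "phase m \<theta> g k"
  shows "continuous_on Ipi (\<lambda>t. t + \<theta> t)"
    "pi + \<theta> pi - (- pi + \<theta> (- pi)) = 2 * pi * of_int (k + 1)"
  using phaseD(4)[OF assms]
  by (auto intro!: continuous_intros weak_deriv_continuous[OF phaseD(1)[OF assms]] simp: algebra_simps)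

text \<open>The difference of two lifts is continuous with values in 2 pi \<int>. These values are 2
  pi apart, so it is constant on the connected interval. This makes \<open>deg\<close> well defined,
  and it later detects zero relative winding near \<plusminus>n.\<close>

lemma lift_difference_constant:
  assumes "continuous_on Ipi \<theta>" "continuous_on Ipi \<eta>"
    and eq: "\<And>t. t \<in> Ipi \<Longrightarrow> nvec (\<theta> t) = nvec (\<eta> t)"
  shows "\<theta> pi - \<theta> (- pi) = \<eta> pi - \<eta> (- pi)"
proof -
  have *: "\<exists>n::int. \<theta> t - \<eta> t = 2 * pi * of_int n" if "t \<in> Ipi" for t
  proof -
    have "cos (\<theta> t) = cos (\<eta> t)" "sin (\<theta> t) = sin (\<eta> t)"
      using eq[OF that] by (metis nvec_nth)+
    then obtain n :: int where "\<theta> t = \<eta> t + 2 * pi * of_int n"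
      using sin_cos_eq_iff[of "\<theta> t" "\<eta> t"] by blast
    then show ?thesis by (intro exI[of _ n]) simp
  qed
  have "(\<lambda>t. \<theta> t - \<eta> t) constant_on Ipi"
  proof (rule continuous_discrete_range_constant)
    show "continuous_on Ipi (\<lambda>t. \<theta> t - \<eta> t)" by (intro continuous_intros assms)
    fix s assume "s \<in> Ipi"
    then obtain n :: int where n: "\<theta> s - \<eta> s = 2 * pi * of_int n" using * by blast
    show "\<exists>e>0. \<forall>t. t \<in> Ipi \<and> \<theta> t - \<eta> t \<noteq> \<theta> s - \<eta> s \<longrightarrow> e \<le> norm (\<theta> t - \<eta> t - (\<theta> s - \<eta> s))"
    proof (intro exI[of _ "2 * pi"] conjI allI impI)
      fix t assume t: "t \<in> Ipi \<and> \<theta> t - \<eta> t \<noteq> \<theta> s - \<eta> s"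
      then obtain l :: int where l: "\<theta> t - \<eta> t = 2 * pi * of_int l" using * by blast
      have "l \<noteq> n" using t l n by auto
      then have "1 \<le> \<bar>real_of_int (l - n)\<bar>" by simp
      then have "2 * pi * 1 \<le> 2 * pi * \<bar>real_of_int (l - n)\<bar>"
        by (intro mult_left_mono) auto
      also have "\<dots> = norm (\<theta> t - \<eta> t - (\<theta> s - \<eta> s))"
        unfolding l n by (simp add: right_diff_distrib[symmetric] abs_mult)
      finally show "2 * pi \<le> norm (\<theta> t - \<eta> t - (\<theta> s - \<eta> s))" by simp
    qed simp
  qed simp
  then obtain c where "\<And>t. t \<in> Ipi \<Longrightarrow> \<theta> t - \<eta> t = c"
    unfolding constant_on_def by blast
  from this[of pi] this[of "- pi"] show ?thesis by simp
qed

lemma deg_lift: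
  assumes "continuous_on Ipi \<theta>" "\<And>t. t \<in> Ipi \<Longrightarrow> m t = nvec (\<theta> t)"
    and "\<theta> pi - \<theta> (- pi) = 2 * pi * of_int d"
  shows "deg m = d"
  unfolding deg_def nvec_def[symmetric]
proof (rule the_equality)
  show "\<exists>\<theta>. continuous_on Ipi \<theta> \<and> (\<forall>t\<in>Ipi. m t = nvec (\<theta> t)) \<and> \<theta> pi - \<theta> (- pi) = 2 * pi * of_int d"
    using assms by blast
  fix d' :: int
  assume "\<exists>\<theta>. continuous_on Ipi \<theta> \<and> (\<forall>t\<in>Ipi. m t = nvec (\<theta> t)) \<and> \<theta> pi - \<theta> (- pi) = 2 * pi * of_int d'"
  then obtain \<eta> where \<eta>: "continuous_on Ipi \<eta>" "\<And>t. t \<in> Ipi \<Longrightarrow> m t = nvec (\<eta> t)"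
    "\<eta> pi - \<eta> (- pi) = 2 * pi * of_int d'" by blast
  have "\<theta> pi - \<theta> (- pi) = \<eta> pi - \<eta> (- pi)"
    by (rule lift_difference_constant[OF assms(1) \<eta>(1)]) (metis assms(2) \<eta>(2))
  then have "2 * pi * of_int d = 2 * pi * real_of_int d'"
    using assms(3) \<eta>(3) by simp
  then show "d' = d" by simp
qed

lemma phase_deg:
  assumes "phase m \<theta> g k"
  shows "deg m = k + 1"
  by (rule deg_lift[OF phase_lift(1)[OF assms] phaseD(3)[OF assms] phase_lift(2)[OF assms]])

lemma weak_deriv_nvec:
  assumes "weak_deriv \<theta> g"
  shows "weak_deriv (\<lambda>t. nvec (t + \<theta> t)) (\<lambda>t. (1 + g t) *\<^sub>R tauvec (t + \<theta> t))"
  unfolding weak_deriv_cart_iff forall_3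
proof (intro conjI)
  have \<Theta>: "weak_deriv (\<lambda>t. t + \<theta> t) (\<lambda>t. 1 + g t)"
    by (rule weak_deriv_add[OF weak_deriv_ident assms])
  have "weak_deriv (\<lambda>t. cos (t + \<theta> t)) (\<lambda>t. - sin (t + \<theta> t) * (1 + g t))"
    by (rule weak_deriv_compose[OF \<Theta>]) (auto intro!: derivative_eq_intros continuous_intros)
  then show "weak_deriv (\<lambda>t. nvec (t + \<theta> t) $ 1) (\<lambda>t. ((1 + g t) *\<^sub>R tauvec (t + \<theta> t)) $ 1)"
    by (simp add: mult.commute)
  have "weak_deriv (\<lambda>t. sin (t + \<theta> t)) (\<lambda>t. cos (t + \<theta> t) * (1 + g t))"
    by (rule weak_deriv_compose[OF \<Theta>]) (auto intro!: derivative_eq_intros continuous_intros)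
  then show "weak_deriv (\<lambda>t. nvec (t + \<theta> t) $ 2) (\<lambda>t. ((1 + g t) *\<^sub>R tauvec (t + \<theta> t)) $ 2)"
    by (simp add: mult.commute)
  show "weak_deriv (\<lambda>t. nvec (t + \<theta> t) $ 3) (\<lambda>t. ((1 + g t) *\<^sub>R tauvec (t + \<theta> t)) $ 3)"
    using weak_deriv_const[of 0] by simp
qed

lemma phase_weak_deriv:
  assumes "phase m \<theta> g k"
  shows "weak_deriv m (\<lambda>t. (1 + g t) *\<^sub>R tauvec (t + \<theta> t))"
  by (rule weak_deriv_cong[OF weak_deriv_nvec[OF phaseD(1)[OF assms]] _ negligible_empty])
     (simp_all add: phaseD(3)[OF assms])

lemma phase_wderiv:
  assumes "phase m \<theta> g k"
  obtains N where "negligible N" "\<And>t. t \<in> Ipi - N \<Longrightarrow> wderiv m t = (1 + g t) *\<^sub>R tauvec (t + \<theta> t)"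
  using weak_deriv_unique_cart[OF weak_deriv_wderiv[OF phase_weak_deriv[OF assms]] phase_weak_deriv[OF assms]]
  by blast

text \<open>The factor \<open>c\<close> serves both signs: \<open>c = 1\<close> for the squared
  speed (1 + g)^2 of a map with phase derivative \<open>g\<close>, \<open>c = -1\<close> for passing
  from an absolute angle to the phase relative to \<open>nvec\<close>.\<close>

lemma square_one_plus_integrable:
  assumes "(g::real\<Rightarrow>real) integrable_on S" "(\<lambda>t. (g t)\<^sup>2) integrable_on S" "(\<lambda>t. 1::real) integrable_on S"
  shows "(\<lambda>t. (1 + c * g t)\<^sup>2) integrable_on S"
    "integral S (\<lambda>t. (1 + c * g t)\<^sup>2) = integral S (\<lambda>t. 1) + 2 * c * integral S g + c\<^sup>2 * integral S (\<lambda>t. (g t)\<^sup>2)"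
proof -
  have "((\<lambda>t. 1 + 2 * c * g t + c\<^sup>2 * (g t)\<^sup>2) has_integral
     integral S (\<lambda>t. 1) + 2 * c * integral S g + c\<^sup>2 * integral S (\<lambda>t. (g t)\<^sup>2)) S"
    using assms by (intro has_integral_add has_integral_mult_right integrable_integral)
  moreover have "(\<lambda>t. 1 + 2 * c * g t + c\<^sup>2 * (g t)\<^sup>2) = (\<lambda>t. (1 + c * g t)\<^sup>2)"
    by (auto simp: power2_eq_square algebra_simps)
  ultimately have *: "((\<lambda>t. (1 + c * g t)\<^sup>2) has_integral
     integral S (\<lambda>t. 1) + 2 * c * integral S g + c\<^sup>2 * integral S (\<lambda>t. (g t)\<^sup>2)) S"
    by simp
  then show "(\<lambda>t. (1 + c * g t)\<^sup>2) integrable_on S"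
    "integral S (\<lambda>t. (1 + c * g t)\<^sup>2) = integral S (\<lambda>t. 1) + 2 * c * integral S g + c\<^sup>2 * integral S (\<lambda>t. (g t)\<^sup>2)"
    by (auto simp: integral_unique)
qed

lemma phase_H1S1:
  assumes "phase m \<theta> g k"
  shows "H1S1 m"
proof -
  have "(\<lambda>t. (1 + 1 * g t)\<^sup>2) integrable_on Ipi"
    by (rule square_one_plus_integrable[OF weak_derivD(2)[OF phaseD(1)[OF assms]] phaseD(2)[OF assms]])
       (rule integrable_const_ivl)
  then have "(\<lambda>t. (norm ((1 + g t) *\<^sub>R tauvec (t + \<theta> t)))\<^sup>2) integrable_on Ipi"
    by (simp add: power_mult_distrib)
  moreover have "m pi = m (- pi)"
  proof -
    have eq: "pi + \<theta> pi = (- pi + \<theta> (- pi)) + 2 * pi * of_int (k + 1)"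
      using phase_lift(2)[OF assms] by simp
    have "cos (pi + \<theta> pi) = cos (- pi + \<theta> (- pi)) \<and> sin (pi + \<theta> pi) = sin (- pi + \<theta> (- pi))"
      using eq sin_cos_eq_iff[of "pi + \<theta> pi" "- pi + \<theta> (- pi)"] by blast
    then show ?thesis
      using phaseD(3)[OF assms, of pi] phaseD(3)[OF assms, of "- pi"]
      by (simp add: nvec_def)
  qed
  ultimately have "H1per m"
    unfolding H1per_def using phase_weak_deriv[OF assms] by blast
  then show ?thesis
    unfolding H1S1_def by (simp add: phaseD(3)[OF assms])
qed

lemma norm_cross_nvec: "(norm (cross3 (nvec (t + \<theta>)) (nvec t)))\<^sup>2 = (sin \<theta>)\<^sup>2"
proof -
  have "cos (t + \<theta>) * sin t - sin (t + \<theta>) * cos t = - sin \<theta>"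
    using sin_diff[of "t + \<theta>" t] by (simp add: algebra_simps)
  then show ?thesis
    by (simp add: norm_sq_real3 cross3_def)
qed

text \<open>The speed is |1 + g|. Expanding its square, the cross term 2 \<integral> g sees only the
  winding and becomes a constant of the degree class.\<close>

lemma phase_Fen:
  assumes "phase m \<theta> g k"
  shows "Fen k2 m = 2 * pi + 4 * pi * of_int k
     + integral Ipi (\<lambda>t. (g t)\<^sup>2) + k2 * integral Ipi (\<lambda>t. (sin (\<theta> t))\<^sup>2)"
proof -
  obtain N where N: "negligible N" "\<And>t. t \<in> Ipi - N \<Longrightarrow> wderiv m t = (1 + g t) *\<^sub>R tauvec (t + \<theta> t)"
    using phase_wderiv[OF assms] by blast
  have "integral Ipi (\<lambda>t. (norm (wderiv m t))\<^sup>2) = integral Ipi (\<lambda>t. (1 + 1 * g t)\<^sup>2)"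
    by (rule integral_spike[OF N(1)]) (simp add: N(2) power_mult_distrib)
  also have "\<dots> = integral Ipi (\<lambda>t. 1) + 2 * 1 * integral Ipi g + 1\<^sup>2 * integral Ipi (\<lambda>t. (g t)\<^sup>2)"
    by (rule square_one_plus_integrable[OF weak_derivD(2)[OF phaseD(1)[OF assms]] phaseD(2)[OF assms]])
       (rule integrable_const_ivl)
  also have "integral Ipi g = 2 * pi * of_int k"
    using weak_deriv_integral[OF phaseD(1)[OF assms]] phaseD(4)[OF assms] by simp
  finally have 1: "integral Ipi (\<lambda>t. (norm (wderiv m t))\<^sup>2)
      = 2 * pi + 4 * pi * of_int k + integral Ipi (\<lambda>t. (g t)\<^sup>2)"
    by simp
  have "integral Ipi (\<lambda>t. (norm (cross3 (m t) (nvec t)))\<^sup>2) = integral Ipi (\<lambda>t. (sin (\<theta> t))\<^sup>2)"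
    by (rule integral_cong) (simp add: phaseD(3)[OF assms] norm_cross_nvec)
  with 1 show ?thesis unfolding Fen_def by simp
qed

text \<open>The lift is built from its derivative: \<Theta> integrates the angular velocity x y' - y
  x', starting at an angle of m(-pi). The scalar product of m with (cos \<Theta>, sin \<Theta>) then
  has zero derivative, so it stays 1, which forces the two unit vectors to coincide.\<close>

lemma H1S1_phase:
  assumes m: "H1S1 m"
  obtains \<theta> g where "phase m \<theta> g (deg m - 1)"
proof -
  obtain g0 where g0: "weak_deriv m g0" "(\<lambda>t. (norm (g0 t))\<^sup>2) integrable_on Ipi"
    and per: "m pi = m (- pi)"
    and m1: "\<And>t. t \<in> Ipi \<Longrightarrow> norm (m t) = 1" and m3: "\<And>t. t \<in> Ipi \<Longrightarrow> m t $ 3 = 0"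
    using m unfolding H1S1_def H1per_def by blast
  define x y x' y' where "x = (\<lambda>t. m t $ 1)" and "y = (\<lambda>t. m t $ 2)"
    and "x' = (\<lambda>t. g0 t $ 1)" and "y' = (\<lambda>t. g0 t $ 2)"
  have wx: "weak_deriv x x'" and wy: "weak_deriv y y'"
    using g0(1) unfolding weak_deriv_cart_iff x_def y_def x'_def y'_def by auto
  have xy1: "(x t)\<^sup>2 + (y t)\<^sup>2 = 1" if "t \<in> Ipi" for t
    using norm_sq_real3[of "m t"] m1[OF that] m3[OF that] by (simp add: x_def y_def)
  \<comment> \<open>Differentiating |m|^2 = 1 gives m orthogonal to m' almost everywhere; hence m' =
    \<omega> (-y, x), as extracted below.\<close>
  have "weak_deriv (\<lambda>t. x t * x t + y t * y t) (\<lambda>t. (x' t * x t + x t * x' t) + (y' t * y t + y t * y' t))"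
    by (intro weak_deriv_add weak_deriv_mult wx wy)
  from weak_deriv_diff[OF this weak_deriv_const[of 1]]
  have "weak_deriv (\<lambda>_. 0) (\<lambda>t. (x' t * x t + x t * x' t) + (y' t * y t + y t * y' t))"
    by (rule weak_deriv_cong[OF _ _ negligible_empty]) (use xy1 in \<open>auto simp: power2_eq_square\<close>)
  then obtain N where N: "negligible N"
    "\<And>t. t \<in> Ipi - N \<Longrightarrow> (x' t * x t + x t * x' t) + (y' t * y t + y t * y' t) = 0"
    using weak_deriv_zero_imp_negligible by blast
  define \<omega> where "\<omega> = (\<lambda>t. x t * y' t - y t * x' t)"
  have \<omega>: "\<omega> absolutely_integrable_on Ipi"
    unfolding \<omega>_def
    by (intro set_integral_diff(1) absolutely_integrable_continuous_mult
        weak_deriv_continuous[OF wx] weak_deriv_continuous[OF wy] weak_derivD(1)[OF wx] weak_derivD(1)[OF wy])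
  have "(x (- pi))\<^sup>2 + (y (- pi))\<^sup>2 = 1" by (rule xy1) simp
  then obtain c where c: "x (- pi) = cos c" "y (- pi) = sin c"
    using sincos_total_2pi by metis
  define \<Theta> where "\<Theta> = (\<lambda>t. c + integral {-pi..t} \<omega>)"
  have \<Theta>0: "\<Theta> (- pi) = c" by (simp add: \<Theta>_def)
  have w\<Theta>: "weak_deriv \<Theta> \<omega>"
    unfolding weak_deriv_def using \<omega> by (simp add: \<Theta>_def)
  have wc: "weak_deriv (\<lambda>t. cos (\<Theta> t)) (\<lambda>t. - sin (\<Theta> t) * \<omega> t)"
    by (rule weak_deriv_compose[OF w\<Theta>]) (auto intro!: derivative_eq_intros continuous_intros)
  have ws: "weak_deriv (\<lambda>t. sin (\<Theta> t)) (\<lambda>t. cos (\<Theta> t) * \<omega> t)"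
    by (rule weak_deriv_compose[OF w\<Theta>]) (auto intro!: derivative_eq_intros continuous_intros)
  define A where "A = (\<lambda>t. x t * cos (\<Theta> t) + y t * sin (\<Theta> t))"
  have "weak_deriv A (\<lambda>t. (x' t * cos (\<Theta> t) + x t * (- sin (\<Theta> t) * \<omega> t))
      + (y' t * sin (\<Theta> t) + y t * (cos (\<Theta> t) * \<omega> t)))"
    unfolding A_def by (intro weak_deriv_add weak_deriv_mult wx wy wc ws)
  then have "weak_deriv A (\<lambda>_. 0)"
  proof (rule weak_deriv_cong[OF _ refl N(1)])
    fix t assume t: "t \<in> Ipi - N"
    then have 1: "x t * x t + y t * y t = 1" and 2: "x t * x' t + y t * y' t = 0"
      using xy1[of t] N(2)[of t] by (auto simp: power2_eq_square algebra_simps)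
    have x': "x' t = - (\<omega> t * y t)" unfolding \<omega>_def using 1 2 by algebra
    have y': "y' t = \<omega> t * x t" unfolding \<omega>_def using 1 2 by algebra
    show "0 = (x' t * cos (\<Theta> t) + x t * (- sin (\<Theta> t) * \<omega> t))
      + (y' t * sin (\<Theta> t) + y t * (cos (\<Theta> t) * \<omega> t))"
      unfolding x' y' by (simp add: algebra_simps)
  qed
  then have A1: "A t = 1" if "t \<in> Ipi" for t
    using weak_derivD(3)[of A "\<lambda>_. 0", OF _ that] by (simp add: A_def \<Theta>0 c)
  have lift: "m t = nvec (\<Theta> t)" if "t \<in> Ipi" for t
  proof -
    have "(x t - cos (\<Theta> t))\<^sup>2 + (y t - sin (\<Theta> t))\<^sup>2 = 0"
      using A1[OF that] xy1[OF that] sin_cos_squared_add[of "\<Theta> t"]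
      unfolding A_def power2_eq_square by (simp add: algebra_simps)
    then have "x t = cos (\<Theta> t) \<and> y t = sin (\<Theta> t)"
      unfolding sum_power2_eq_zero_iff by simp
    then show ?thesis
      by (intro cart3_eqI) (auto simp: x_def y_def m3[OF that])
  qed
  have "(\<lambda>t. (\<omega> t)\<^sup>2) absolutely_integrable_on Ipi"
  proof (rule measurable_bounded_by_integrable_imp_absolutely_integrable[OF _ _ g0(2)])
    show "(\<lambda>t. (\<omega> t)\<^sup>2) \<in> borel_measurable (lebesgue_on Ipi)"
      using absolutely_integrable_imp_borel_measurable[OF \<omega>] by simp
    fix t assume t: "t \<in> Ipi"
    \<comment> \<open>Lagrange's identity for the pairs (x, y) and (x', y') bounds the angular
      velocity by |m'|, which passes square integrability on to the phase.\<close>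
    have "(\<omega> t)\<^sup>2 \<le> (\<omega> t)\<^sup>2 + (x t * x' t + y t * y' t)\<^sup>2" by simp
    also have "\<dots> = ((x t)\<^sup>2 + (y t)\<^sup>2) * ((x' t)\<^sup>2 + (y' t)\<^sup>2)"
      unfolding \<omega>_def power2_eq_square by (simp add: algebra_simps)
    also have "\<dots> = (x' t)\<^sup>2 + (y' t)\<^sup>2" using xy1[OF t] by simp
    also have "\<dots> \<le> (norm (g0 t))\<^sup>2" unfolding norm_sq_real3 x'_def y'_def by simp
    finally show "norm ((\<omega> t)\<^sup>2) \<le> (norm (g0 t))\<^sup>2" by simp
  qed simp
  then have \<omega>2: "(\<lambda>t. (\<omega> t)\<^sup>2) integrable_on Ipi"
    by (simp add: absolutely_integrable_on_def)
  have "nvec (\<Theta> pi) = nvec (\<Theta> (- pi))"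
    using per lift[of pi] lift[of "- pi"] by simp
  then have "sin (\<Theta> pi) = sin (\<Theta> (- pi)) \<and> cos (\<Theta> pi) = cos (\<Theta> (- pi))"
    by (metis nvec_nth)
  then obtain n :: int where "\<Theta> pi = \<Theta> (- pi) + 2 * pi * of_int n"
    using sin_cos_eq_iff by blast
  then have n: "\<Theta> pi - \<Theta> (- pi) = 2 * pi * of_int n" by simp
  have "deg m = n"
    by (rule deg_lift[OF weak_deriv_continuous[OF w\<Theta>] lift n])
  show thesis
  proof (rule that[of "\<lambda>t. \<Theta> t - t" "\<lambda>t. \<omega> t - 1"])
    have "(\<lambda>t. (1 + (- 1) * \<omega> t)\<^sup>2) integrable_on Ipi"
      by (rule square_one_plus_integrable[OF weak_derivD(2)[OF w\<Theta>] \<omega>2]) (rule integrable_const_ivl)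
    then have "(\<lambda>t. (\<omega> t - 1)\<^sup>2) integrable_on Ipi"
      by (simp add: power2_commute)
    then show "phase m (\<lambda>t. \<Theta> t - t) (\<lambda>t. \<omega> t - 1) (deg m - 1)"
      unfolding phase_def
      using weak_deriv_diff[OF w\<Theta> weak_deriv_ident] lift n \<open>deg m = n\<close>
      by (simp add: algebra_simps)
  qed
qed

section \<open>The amplitude function\<close>

text \<open>The antiderivative vanishing at \<open>- pi\<close>, on the whole line; the case split
  copies that of \<open>Fk\<close>, which thereby becomes an instance.\<close>

definition primitive :: "(real \<Rightarrow> real) \<Rightarrow> real \<Rightarrow> real" where
  "primitive f x = (if - pi \<le> x then integral {- pi..x} f else - integral {x..- pi} f)"

text \<open>Moving the base point to the left of both \<open>- pi\<close> and \<open>x\<close>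
  removes the case split, so that differentiation near \<open>- pi\<close> needs no special
  treatment.\<close>

lemma primitive_eq_integral_diff:
  assumes "continuous_on UNIV f" "M \<le> - pi" "M \<le> x"
  shows "primitive f x = integral {M..x} f - integral {M..- pi} f"
proof -
  have int: "f integrable_on {a..b}" for a b
    by (rule integrable_continuous_real[OF continuous_on_subset[OF assms(1)]]) simp
  show ?thesis
  proof (cases "- pi \<le> x")
    case True
    then show ?thesis
      using Henstock_Kurzweil_Integration.integral_combine[OF assms(2) True int] by (simp add: primitive_def)
  next
    case False
    then show ?thesis
      using Henstock_Kurzweil_Integration.integral_combine[OF assms(3) _ int, of "- pi"] by (simp add: primitive_def)
  qed
qed

lemma primitive_deriv:
  assumes f: "continuous_on UNIV f"
  shows "(primitive f has_real_derivative f x) (at x)"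
proof -
  define M where "M = max \<bar>x\<bar> pi + 1"
  have M: "- M < x" "x < M" "- M \<le> - pi" by (auto simp: M_def)
  have "((\<lambda>y. integral {- M..y} f) has_real_derivative f x) (at x within {- M..M})"
    by (rule integral_has_real_derivative[OF continuous_on_subset[OF f]]) (use M in auto)
  then have "((\<lambda>y. integral {- M..y} f) has_real_derivative f x) (at x)"
    using M by (simp add: at_within_Icc_at)
  from DERIV_diff[OF this DERIV_const[of "integral {- M..- pi} f"]]
  have "((\<lambda>y. integral {- M..y} f - integral {- M..- pi} f) has_real_derivative f x) (at x)"
    by simp
  moreover have "\<forall>\<^sub>F y in nhds x. primitive f y = integral {- M..y} f - integral {- M..- pi} f"
    using eventually_nhds_in_open[of "{- M<..<M}" x] M
    by (auto elim!: eventually_mono intro!: primitive_eq_integral_diff[OF f])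
  ultimately show ?thesis
    by (simp add: DERIV_cong_ev[OF refl _ refl])
qed

lemma primitive_add_period:
  assumes f: "continuous_on UNIV f" and per: "\<And>x. f (x + 2 * pi) = f x"
  shows "primitive f (x + 2 * pi) = primitive f x + integral Ipi f"
proof -
  have "((\<lambda>x. primitive f (x + 2 * pi) - primitive f x) has_real_derivative 0) (at y)" for y
    using DERIV_diff[OF DERIV_shift[THEN iffD1, OF primitive_deriv[OF f, of "y + 2 * pi"]]
        primitive_deriv[OF f, of y]] per[of y] by simp
  then have "primitive f (x + 2 * pi) - primitive f x = primitive f (- pi + 2 * pi) - primitive f (- pi)"
    using DERIV_isconst_all by blast
  also have "\<dots> = integral Ipi f"
    by (simp add: primitive_def)
  finally show ?thesis by simp
qed

lemma primitive_add_nat_period: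
  assumes f: "continuous_on UNIV f" and per: "\<And>x. f (x + 2 * pi) = f x"
  shows "primitive f (x + 2 * pi * of_nat n) = primitive f x + of_nat n * integral Ipi f"
proof (induction n)
  case (Suc n)
  have "x + 2 * pi * of_nat (Suc n) = (x + 2 * pi * of_nat n) + 2 * pi"
    by (simp add: algebra_simps)
  then show ?case
    using primitive_add_period[OF f per, of "x + 2 * pi * of_nat n"] Suc
    by (simp add: algebra_simps)
qed simp

lemma primitive_add_int_period:
  assumes f: "continuous_on UNIV f" and per: "\<And>x. f (x + 2 * pi) = f x"
  shows "primitive f (x + 2 * pi * of_int n) = primitive f x + of_int n * integral Ipi f"
proof (cases n)
  case (nonneg k)
  then show ?thesis using primitive_add_nat_period[OF f per, of x k] by simp
next
  case (neg k)
  then have n: "real_of_int n = - of_nat (Suc k)" by simp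
  have x: "x + 2 * pi * of_int n + 2 * pi * of_nat (Suc k) = x"
    unfolding n by (simp add: algebra_simps)
  have "primitive f x = primitive f (x + 2 * pi * of_int n) + of_nat (Suc k) * integral Ipi f"
    using primitive_add_nat_period[OF f per, of "x + 2 * pi * of_int n" "Suc k"] unfolding x .
  then show ?thesis
    unfolding n by (simp add: algebra_simps)
qed

section \<open>The radical and the normalisation that defines \<open>alpha\<close>\<close>

definition rad :: "real \<Rightarrow> real \<Rightarrow> real \<Rightarrow> real" where
  "rad k2 a x = sqrt (a\<^sup>2 + k2 * (sin x)\<^sup>2)"

lemma radicand_pos: "k2 > 0 \<Longrightarrow> a > 0 \<Longrightarrow> a\<^sup>2 + k2 * (sin x)\<^sup>2 > (0::real)"
  by (intro add_pos_nonneg) auto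

lemma rad_pos: "k2 > 0 \<Longrightarrow> a > 0 \<Longrightarrow> rad k2 a x > 0"
  using radicand_pos by (simp add: rad_def)

lemma rad_square: "k2 > 0 \<Longrightarrow> a > 0 \<Longrightarrow> (rad k2 a x)\<^sup>2 = a\<^sup>2 + k2 * (sin x)\<^sup>2"
  using radicand_pos[of k2 a x] by (simp add: rad_def)

lemma rad_continuous [continuous_intros]: "continuous_on S (rad k2 a)"
  unfolding rad_def by (intro continuous_intros)

lemma rad_periodic: "rad k2 a (x + 2 * pi) = rad k2 a x"
  by (simp add: rad_def)

lemma inverse_rad_continuous:
  assumes "k2 > 0" "a > 0"
  shows "continuous_on S (\<lambda>x. c / rad k2 a x)"
  using rad_pos[OF assms] by (intro continuous_intros) (auto simp: less_imp_neq[symmetric] intro: less_imp_neq)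

lemma inverse_rad_antimono:
  assumes "k2 > 0" "0 < a" "a < b"
  shows "integral Ipi (\<lambda>x. 1 / rad k2 b x) < integral Ipi (\<lambda>x. 1 / rad k2 a x)"
proof (rule integral_less_real)
  show "1 / rad k2 b x < 1 / rad k2 a x" for x
  proof -
    have "a\<^sup>2 < b\<^sup>2" using assms by (intro power_strict_mono) auto
    then have "rad k2 a x < rad k2 b x" by (simp add: rad_def)
    then show ?thesis using rad_pos[of k2 a x] assms by (intro divide_strict_left_mono) (auto simp: rad_pos)
  qed
qed (use assms pi_gt_zero in \<open>auto intro!: inverse_rad_continuous simp del: pi_gt_zero\<close>)

lemma inverse_rad_integral_continuous:
  assumes "k2 > 0"
  shows "continuous_on {0<..} (\<lambda>a. integral Ipi (\<lambda>x. 1 / rad k2 a x))"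
proof -
  have "continuous_on ({0<..} \<times> cbox (- pi) pi) (\<lambda>(a, x). 1 / rad k2 a x)"
    unfolding rad_def split_beta using radicand_pos[OF assms]
    by (intro continuous_intros) (auto simp: less_imp_neq[symmetric] intro: less_imp_neq)
  from integral_continuous_on_param[OF this] show ?thesis by simp
qed

text \<open>The integral diverges logarithmically as a tends to 0: sin x \<le> x gives
  \<open>rad\<close> \<le> a + k x on [0, pi], with k = sqrt \<open>k2\<close>, and 1 / (a + k x)
  has integral ln (1 + k pi / a) / k there.\<close>

lemma inverse_rad_integral_unbounded:
  assumes k2: "k2 > 0"
  obtains a where "a > 0" "2 * pi \<le> integral Ipi (\<lambda>x. 1 / rad k2 a x)"
proof -
  define k where "k = sqrt k2"
  have k: "k > 0" "k\<^sup>2 = k2" using k2 by (auto simp: k_def)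
  \<comment> \<open>Chosen to make k pi / a equal to exp (2 pi k), so that the logarithm exceeds 2
    pi k.\<close>
  define a where "a = k * pi / exp (2 * pi * k)"
  have a: "a > 0" using k by (simp add: a_def)
  have "((\<lambda>x. 1 / (a + k * x)) has_integral (ln (a + k * pi) / k - ln (a + k * 0) / k)) {0..pi}"
  proof (rule fundamental_theorem_of_calculus)
    fix x assume "x \<in> {0..pi}"
    then have "a + k * x > 0" using a k by (intro add_pos_nonneg) auto
    then have "((\<lambda>x. ln (a + k * x) / k) has_real_derivative (1 / (a + k * x) * k) / k) (at x within {0..pi})"
      by (auto intro!: derivative_eq_intros)
    then have "((\<lambda>x. ln (a + k * x) / k) has_real_derivative 1 / (a + k * x)) (at x within {0..pi})"
      using k by simp
    then show "((\<lambda>x. ln (a + k * x) / k) has_vector_derivative 1 / (a + k * x)) (at x within {0..pi})"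
      by (simp add: has_real_derivative_iff_has_vector_derivative)
  qed simp
  then have int: "(\<lambda>x. 1 / (a + k * x)) integrable_on {0..pi}"
    "integral {0..pi} (\<lambda>x. 1 / (a + k * x)) = (ln (a + k * pi) - ln a) / k"
    by (auto simp: integral_unique diff_divide_distrib)
  have "a + k * pi > 0" using a k by (intro add_pos_pos) auto
  then have "ln (a + k * pi) - ln a = ln ((a + k * pi) / a)"
    using a by (simp add: ln_div)
  also have "(a + k * pi) / a = 1 + exp (2 * pi * k)"
    using a k unfolding a_def by (simp add: field_simps)
  also have "ln (1 + exp (2 * pi * k)) \<ge> ln (exp (2 * pi * k))"
    by (subst ln_le_cancel_iff) (auto intro: add_pos_pos)
  finally have "2 * pi * k \<le> ln (a + k * pi) - ln a" by simp
  then have "2 * pi \<le> integral {0..pi} (\<lambda>x. 1 / (a + k * x))"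
    unfolding int(2) using k by (simp add: field_simps)
  also have "\<dots> \<le> integral {0..pi} (\<lambda>x. 1 / rad k2 a x)"
  proof (rule integral_le[OF int(1)])
    show "(\<lambda>x. 1 / rad k2 a x) integrable_on {0..pi}"
      by (intro integrable_continuous_real inverse_rad_continuous k2 a)
    fix x assume x: "x \<in> {0..pi}"
    have "0 \<le> sin x" "sin x \<le> x" using x by (auto intro: sin_ge_zero sin_x_le_x)
    then have "(sin x)\<^sup>2 \<le> x\<^sup>2" by (intro power_mono)
    then have "k2 * (sin x)\<^sup>2 \<le> k2 * x\<^sup>2" using k2 by simp
    moreover have "a\<^sup>2 + k2 * x\<^sup>2 \<le> (a + k * x)\<^sup>2"
    proof -
      have "(a + k * x)\<^sup>2 = a\<^sup>2 + k2 * x\<^sup>2 + 2 * a * (k * x)"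
        unfolding k(2)[symmetric] by (simp add: power2_eq_square algebra_simps)
      then show ?thesis using a k x by simp
    qed
    ultimately have "rad k2 a x \<le> sqrt ((a + k * x)\<^sup>2)"
      unfolding rad_def by (intro real_sqrt_le_mono) linarith
    also have "\<dots> = a + k * x" using a k x by simp
    finally show "1 / (a + k * x) \<le> 1 / rad k2 a x"
      using rad_pos[OF k2 a, of x] by (intro divide_left_mono) auto
  qed
  also have "\<dots> \<le> integral Ipi (\<lambda>x. 1 / rad k2 a x)"
    by (rule integral_subset_le)
       (use rad_pos[OF k2 a] in \<open>auto intro!: integrable_continuous_real inverse_rad_continuous k2 a simp: less_imp_le\<close>)
  finally show thesis using a that by blast
qed

text \<open>Intermediate values between a small \<open>a\<close>, where the integral is at least 2
  pi, and \<open>a = 1\<close>, where the radical is at least 1 and the integral at most 2 pi.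
  Strict decrease in \<open>a\<close> gives uniqueness.\<close>

lemma alpha_unique_existence:
  assumes k2: "k2 > 0"
  shows "\<exists>!a. a > 0 \<and> integral Ipi (\<lambda>x. 1 / rad k2 a x) = 2 * pi"
proof (rule ex_ex1I)
  let ?J = "\<lambda>a. integral Ipi (\<lambda>x. 1 / rad k2 a x)"
  obtain a where a: "a > 0" "2 * pi \<le> ?J a" using inverse_rad_integral_unbounded[OF k2] .
  have J1: "?J 1 \<le> 2 * pi"
  proof -
    have "?J 1 \<le> integral Ipi (\<lambda>x. 1::real)"
    proof (rule integral_le)
      show "(\<lambda>x. 1 / rad k2 1 x) integrable_on Ipi"
        by (intro integrable_continuous_real inverse_rad_continuous k2) simp
      have "1 \<le> rad k2 1 x" for x
        unfolding rad_def using k2 by (intro real_le_rsqrt) simp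
      then show "1 / rad k2 1 x \<le> 1" for x
        using rad_pos[OF k2, of 1 x] by simp
    qed (rule integrable_const_ivl)
    then show ?thesis by simp
  qed
  have "a \<le> 1"
    using inverse_rad_antimono[OF k2, of 1 a] J1 a by force
  have "\<exists>x\<ge>a. x \<le> 1 \<and> ?J x = 2 * pi"
  proof (rule IVT2'[where f="?J", OF J1 a(2) \<open>a \<le> 1\<close>])
    show "continuous_on {a..1} ?J"
      by (rule continuous_on_subset[OF inverse_rad_integral_continuous[OF k2]]) (use a in auto)
  qed
  then show "\<exists>a. a > 0 \<and> ?J a = 2 * pi" using a(1) by (meson less_le_trans)
  show "\<And>a b. a > 0 \<and> ?J a = 2 * pi \<Longrightarrow> b > 0 \<and> ?J b = 2 * pi \<Longrightarrow> a = b"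
    using inverse_rad_antimono[OF k2] by (metis less_irrefl linorder_neqE_linordered_idom)
qed

lemma alpha:
  assumes "k2 > 0"
  shows "alpha k2 > 0" "integral Ipi (\<lambda>x. 1 / rad k2 (alpha k2) x) = 2 * pi"
proof -
  have eq: "1 / (2 * pi) * y = 1 \<longleftrightarrow> y = 2 * pi" for y by (auto simp: field_simps)
  have "alpha k2 = (THE a. a > 0 \<and> integral Ipi (\<lambda>x. 1 / rad k2 a x) = 2 * pi)"
    unfolding alpha_def rad_def eq ..
  then show "alpha k2 > 0" "integral Ipi (\<lambda>x. 1 / rad k2 (alpha k2) x) = 2 * pi"
    using theI'[OF alpha_unique_existence[OF assms]] by auto
qed

section \<open>From the radical to \<open>Fk\<close> and its inverse \<open>am\<close>\<close>

lemma rad_scaled: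
  assumes "k2 > 0" "a > 0"
  shows "sqrt (1 + k2 / a\<^sup>2 * (sin x)\<^sup>2) = rad k2 a x / a"
proof -
  have "1 + k2 / a\<^sup>2 * (sin x)\<^sup>2 = (a\<^sup>2 + k2 * (sin x)\<^sup>2) / a\<^sup>2"
    using assms by (simp add: field_simps)
  then show ?thesis using assms by (simp add: rad_def real_sqrt_divide)
qed

lemma alpha_Ek:
  assumes "k2 > 0"
  shows "alpha k2 * Ek k2 = integral Ipi (rad k2 (alpha k2))"
  unfolding Ek_def rad_scaled[OF assms alpha(1)[OF assms]] integral_mult_right[symmetric]
  using alpha(1)[OF assms] by simp

lemma Fk_eq_primitive:
  assumes "k2 > 0"
  shows "Fk k2 = primitive (\<lambda>x. alpha k2 / rad k2 (alpha k2) x)"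
  unfolding Fk_def primitive_def Let_def rad_scaled[OF assms alpha(1)[OF assms]] by (rule ext) simp

lemma Fk_deriv:
  assumes "k2 > 0"
  shows "(Fk k2 has_real_derivative alpha k2 / rad k2 (alpha k2) x) (at x)"
  unfolding Fk_eq_primitive[OF assms]
  by (rule primitive_deriv) (rule inverse_rad_continuous[OF assms alpha(1)[OF assms]])

text \<open>This is where the normalisation of \<open>alpha\<close> enters the dynamics: one turn of
  the angle costs exactly 2 pi \<open>alpha\<close> in the argument of \<open>am\<close>.\<close>

lemma Fk_add_int_period:
  assumes "k2 > 0"
  shows "Fk k2 (x + 2 * pi * of_int n) = Fk k2 x + of_int n * (2 * pi * alpha k2)"
proof -
  have "integral Ipi (\<lambda>x. alpha k2 / rad k2 (alpha k2) x)
      = integral Ipi (\<lambda>x. alpha k2 * (1 / rad k2 (alpha k2) x))" by simp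
  also have "\<dots> = alpha k2 * (2 * pi)"
    unfolding integral_mult_right alpha(2)[OF assms] ..
  finally show ?thesis
    unfolding Fk_eq_primitive[OF assms]
    by (subst primitive_add_int_period)
       (use inverse_rad_continuous[OF assms alpha(1)[OF assms]] in \<open>auto simp: rad_periodic\<close>)
qed

lemma Fk_strict_mono:
  assumes "k2 > 0"
  shows "strict_mono (Fk k2)"
proof (rule strict_monoI)
  fix x y :: real assume "x < y"
  then show "Fk k2 x < Fk k2 y"
    by (rule DERIV_pos_imp_increasing)
       (use Fk_deriv[OF assms] alpha(1)[OF assms] rad_pos[OF assms alpha(1)[OF assms]]
         in \<open>blast intro: divide_pos_pos\<close>)
qed

text \<open>Each period adds the fixed positive amount 2 pi \<open>alpha\<close>, so any value is
  bracketed by finitely many periods on either side of 0.\<close>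

lemma Fk_surj:
  assumes "k2 > 0"
  shows "\<exists>x. Fk k2 x = y"
proof -
  have c: "2 * pi * alpha k2 > 0" using alpha(1)[OF assms] by simp
  obtain n :: int where n: "\<bar>(y - Fk k2 0) / (2 * pi * alpha k2)\<bar> \<le> of_int n"
    using ex_le_of_int by blast
  have "\<bar>y - Fk k2 0\<bar> / (2 * pi * alpha k2) \<le> of_int n"
    using n c by (simp only: abs_divide abs_of_pos)
  then have "\<bar>y - Fk k2 0\<bar> \<le> of_int n * (2 * pi * alpha k2)"
    using c by (simp only: pos_divide_le_eq)
  then have b: "Fk k2 (0 + 2 * pi * of_int (- n)) \<le> y" "y \<le> Fk k2 (0 + 2 * pi * of_int n)"
    unfolding Fk_add_int_period[OF assms] by (auto simp: abs_le_iff)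
  have "n \<ge> 0" using n by (smt (verit) abs_ge_zero of_int_0_le_iff)
  have "\<exists>x\<ge>0 + 2 * pi * of_int (- n). x \<le> 0 + 2 * pi * of_int n \<and> Fk k2 x = y"
  proof (rule IVT'[where f="Fk k2", OF b])
    show "0 + 2 * pi * real_of_int (- n) \<le> 0 + 2 * pi * real_of_int n"
      using \<open>n \<ge> 0\<close> by (intro add_mono mult_left_mono) auto
    show "continuous_on {0 + 2 * pi * real_of_int (- n)..0 + 2 * pi * real_of_int n} (Fk k2)"
      by (intro continuous_at_imp_continuous_on ballI DERIV_isCont[OF Fk_deriv[OF assms]])
  qed
  then show ?thesis by blast
qed

lemma am_Fk: "k2 > 0 \<Longrightarrow> am k2 (Fk k2 x) = x"
  unfolding am_def using strict_mono_eq[OF Fk_strict_mono] by (intro the_equality) auto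

lemma Fk_am: "k2 > 0 \<Longrightarrow> Fk k2 (am k2 y) = y"
  using Fk_surj[of k2 y] am_Fk by metis

text \<open>By this formula, \<theta>(t) = am(- \<open>alpha\<close> t + b) solves the first-order
  equation \<theta>' = - r(\<theta>), the vanishing of the completed square.\<close>

lemma am_deriv:
  assumes k2: "k2 > 0"
  shows "(am k2 has_real_derivative rad k2 (alpha k2) (am k2 y) / alpha k2) (at y)"
proof -
  have "isCont (am k2) (Fk k2 (am k2 y))"
    by (rule isCont_inverse_function[where d=1])
       (auto simp: am_Fk[OF k2] intro: DERIV_isCont[OF Fk_deriv[OF k2]])
  then have cont: "isCont (am k2) y" by (simp add: Fk_am[OF k2])
  have "(am k2 has_real_derivative inverse (alpha k2 / rad k2 (alpha k2) (am k2 y))) (at y)"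
    by (rule DERIV_inverse_function[where a="y - 1" and b="y + 1", OF Fk_deriv[OF k2] _ _ _ _ cont])
       (use alpha(1)[OF k2] rad_pos[OF k2 alpha(1)[OF k2], of "am k2 y"] in \<open>auto simp: Fk_am[OF k2]\<close>)
  then show ?thesis by simp
qed

lemma am_minus_period:
  assumes k2: "k2 > 0"
  shows "am k2 (y - 2 * pi * alpha k2) = am k2 y - 2 * pi"
proof -
  have "Fk k2 (am k2 y - 2 * pi) = y - 2 * pi * alpha k2"
    using Fk_add_int_period[OF k2, of "am k2 y" "-1"] by (simp add: Fk_am[OF k2])
  then show ?thesis using am_Fk[OF k2] by metis
qed

section \<open>Energy lower bounds\<close>

text \<open>Completing the square in the energy against an antiderivative of the radical: the cross term
  is a null Lagrangian.\<close>

lemma phase_Fen_square: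
  assumes k2: "k2 > 0" and a: "a > 0" and m: "phase m \<theta> g k"
  shows "(\<lambda>t. (g t + rad k2 a (\<theta> t))\<^sup>2) absolutely_integrable_on Ipi"
    "Fen k2 m = 2 * pi + 4 * pi * of_int k - 2 * of_int k * integral Ipi (rad k2 a) - 2 * pi * a\<^sup>2
       + integral Ipi (\<lambda>t. (g t + rad k2 a (\<theta> t))\<^sup>2)"
proof -
  note \<theta> = phaseD(1)[OF m]
  have \<theta>c: "continuous_on Ipi \<theta>" by (rule weak_deriv_continuous[OF \<theta>])
  have "weak_deriv (\<lambda>t. primitive (rad k2 a) (\<theta> t)) (\<lambda>t. rad k2 a (\<theta> t) * g t)"
    by (rule weak_deriv_compose[OF \<theta>]) (intro primitive_deriv rad_continuous)+
  note \<Psi> = weak_deriv_integral[OF this] weak_derivD(2)[OF this]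
  have "\<theta> pi = \<theta> (- pi) + 2 * pi * of_int k" using phaseD(4)[OF m] by simp
  then have cross: "integral Ipi (\<lambda>t. rad k2 a (\<theta> t) * g t) = of_int k * integral Ipi (rad k2 a)"
    unfolding \<Psi>(1) by (simp add: primitive_add_int_period rad_continuous rad_periodic)
  have sin: "(\<lambda>t. (sin (\<theta> t))\<^sup>2) integrable_on Ipi"
    by (intro integrable_continuous_real continuous_intros \<theta>c)
  have eq: "(g t + rad k2 a (\<theta> t))\<^sup>2
      = (g t)\<^sup>2 + 2 * (rad k2 a (\<theta> t) * g t) + (a\<^sup>2 + k2 * (sin (\<theta> t))\<^sup>2)" for t
    unfolding rad_square[OF k2 a, symmetric] by (simp add: power2_sum)
  have "((\<lambda>t. (g t)\<^sup>2 + 2 * (rad k2 a (\<theta> t) * g t) + (a\<^sup>2 + k2 * (sin (\<theta> t))\<^sup>2)) has_integral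
      integral Ipi (\<lambda>t. (g t)\<^sup>2) + 2 * (of_int k * integral Ipi (rad k2 a))
      + (integral Ipi (\<lambda>t. a\<^sup>2) + k2 * integral Ipi (\<lambda>t. (sin (\<theta> t))\<^sup>2))) Ipi"
    unfolding cross[symmetric]
    by (intro has_integral_add has_integral_mult_right integrable_integral phaseD(2)[OF m] \<Psi>(2) sin
        integrable_const_ivl)
  then have *: "((\<lambda>t. (g t + rad k2 a (\<theta> t))\<^sup>2) has_integral
      integral Ipi (\<lambda>t. (g t)\<^sup>2) + 2 * (of_int k * integral Ipi (rad k2 a))
      + (integral Ipi (\<lambda>t. a\<^sup>2) + k2 * integral Ipi (\<lambda>t. (sin (\<theta> t))\<^sup>2))) Ipi"
    unfolding eq .
  show "(\<lambda>t. (g t + rad k2 a (\<theta> t))\<^sup>2) absolutely_integrable_on Ipi"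
    by (rule nonnegative_absolutely_integrable_1) (use * in auto)
  show "Fen k2 m = 2 * pi + 4 * pi * of_int k - 2 * of_int k * integral Ipi (rad k2 a) - 2 * pi * a\<^sup>2
       + integral Ipi (\<lambda>t. (g t + rad k2 a (\<theta> t))\<^sup>2)"
    unfolding phase_Fen[OF m] integral_unique[OF *] by simp
qed

text \<open>The least energy at degree zero, raised by 2 pi. Since the least energy at degree one is
  2 pi, the two classes tie exactly when this equals 4 pi.\<close>

definition excess :: "real \<Rightarrow> real" where
  "excess k2 = 2 * integral Ipi (rad k2 (alpha k2)) - 2 * pi * (alpha k2)\<^sup>2"

lemma excess_alpha_Ek:
  assumes "k2 > 0"
  shows "excess k2 = - 2 * pi * (alpha k2)\<^sup>2 + 2 * alpha k2 * Ek k2"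
  using alpha_Ek[OF assms] by (simp add: excess_def)

text \<open>The arithmetic-geometric inequality with equality at q = r. The free \<open>q\<close> is
  later the radical of another parameter (a tangent bound) or the reciprocal of a polynomial
  weight.\<close>

lemma two_rad_le:
  assumes "k2 > 0" "b > 0" "q > 0"
  shows "2 * rad k2 b x \<le> (b\<^sup>2 + k2 * (sin x)\<^sup>2) / q + q"
proof -
  have "2 * rad k2 b x * q \<le> (rad k2 b x)\<^sup>2 + q\<^sup>2" by (rule sum_squares_bound)
  then show ?thesis
    using assms(3) unfolding rad_square[OF assms(1,2), symmetric]
    by (simp add: field_simps power2_eq_square)
qed

lemma rad_integrable: "rad k2 a integrable_on {c..d}"
  by (intro integrable_continuous_real rad_continuous)

text \<open>The excess is the maximum over $b$ of a function that is concave in $b^2$ and whose critical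
  point is the normalisation defining $\alpha_\kappa$.\<close>

lemma excess_ge:
  assumes k2: "k2 > 0" and b: "b > 0"
  shows "2 * integral Ipi (rad k2 b) - 2 * pi * b\<^sup>2 \<le> excess k2"
proof -
  let ?a = "alpha k2"
  note a = alpha[OF k2]
  have int: "(\<lambda>x. 1 / rad k2 ?a x) integrable_on Ipi"
    by (intro integrable_continuous_real inverse_rad_continuous k2 a)
  \<comment> \<open>The integrand is the tangent of 2 r in the variable b^2 at b =
    \<open>alpha\<close>. Because 1 / r has integral 2 pi there, its linear part integrates to
    exactly 2 pi (b^2 - \<open>alpha\<close>^2).\<close>
  have hi: "((\<lambda>x. (b\<^sup>2 - ?a\<^sup>2) * (1 / rad k2 ?a x) + 2 * rad k2 ?a x) has_integral
     (b\<^sup>2 - ?a\<^sup>2) * (2 * pi) + 2 * integral Ipi (rad k2 ?a)) Ipi"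
    unfolding a(2)[symmetric]
    by (intro has_integral_add has_integral_mult_right integrable_integral int rad_integrable)
  have "integral Ipi (\<lambda>x. 2 * rad k2 b x) \<le> (b\<^sup>2 - ?a\<^sup>2) * (2 * pi) + 2 * integral Ipi (rad k2 ?a)"
  proof (rule has_integral_le[OF integrable_integral hi])
    show "(\<lambda>x. 2 * rad k2 b x) integrable_on Ipi"
      by (intro integrable_continuous_real continuous_intros)
    fix x
    have r: "rad k2 ?a x > 0" by (rule rad_pos[OF k2 a(1)])
    have "b\<^sup>2 + k2 * (sin x)\<^sup>2 = (b\<^sup>2 - ?a\<^sup>2) + (rad k2 ?a x)\<^sup>2"
      using rad_square[OF k2 a(1), of x] by simp
    then show "2 * rad k2 b x \<le> (b\<^sup>2 - ?a\<^sup>2) * (1 / rad k2 ?a x) + 2 * rad k2 ?a x"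
      using two_rad_le[OF k2 b r, of x] r by (simp add: field_simps power2_eq_square)
  qed
  then show ?thesis by (simp add: excess_def algebra_simps)
qed

text \<open>Strictness fails where the sine vanishes, and 0 is an interior point of
  \<open>Ipi\<close>; hence a strict comparison on (0, pi) and a weak one on the other half.\<close>

lemma rad_integral_strict_mono:
  assumes "0 < s" "s < t" "a > 0"
  shows "integral Ipi (rad s a) < integral Ipi (rad t a)"
proof -
  have le: "integral {c..d} (rad s a) \<le> integral {c..d} (rad t a)" for c d
    by (rule integral_le[OF rad_integrable rad_integrable])
       (use assms in \<open>auto simp: rad_def intro!: mult_right_mono\<close>)
  have "integral {0..pi} (rad s a) < integral {0..pi} (rad t a)"
  proof (rule integral_less_real)
    fix x assume "x \<in> {0<..<pi}"
    then have "sin x > 0" by (auto intro: sin_gt_zero)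
    then show "rad s a x < rad t a x" using assms by (auto simp: rad_def)
  qed (auto intro!: rad_continuous simp: not_le)
  with le[of "- pi" 0] show ?thesis
    using Henstock_Kurzweil_Integration.integral_combine[OF _ _ rad_integrable, of "- pi" 0 pi s a]
      Henstock_Kurzweil_Integration.integral_combine[OF _ _ rad_integrable, of "- pi" 0 pi t a] by simp
qed

text \<open>Keeping \<open>alpha s\<close> as competitor in the maximum for \<open>t\<close> lets
  only the coefficient of the squared sine change.\<close>

lemma excess_strict_mono:
  assumes "0 < s" "s < t"
  shows "excess s < excess t"
proof -
  have "excess s < 2 * integral Ipi (rad t (alpha s)) - 2 * pi * (alpha s)\<^sup>2"
    using rad_integral_strict_mono[OF assms alpha(1)[OF assms(1)]] by (simp add: excess_def)
  also have "\<dots> \<le> excess t"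
    by (rule excess_ge) (use assms alpha(1) in auto)
  finally show ?thesis .
qed

text \<open>Here \<open>alpha t\<close> competes in the maximum for \<open>s\<close>. Subadditivity
  of the square root bounds the change of the radical by sqrt (t - s), uniformly in
  \<open>alpha\<close>.\<close>

lemma excess_modulus:
  assumes "0 < s" "s \<le> t"
  shows "excess t \<le> excess s + 4 * pi * sqrt (t - s)"
proof -
  let ?a = "alpha t"
  have t: "t > 0" using assms by simp
  have a: "?a > 0" by (rule alpha(1)[OF t])
  have "integral Ipi (rad t ?a) \<le> integral Ipi (\<lambda>x. rad s ?a x + sqrt (t - s))"
  proof (rule integral_le[OF rad_integrable])
    show "(\<lambda>x. rad s ?a x + sqrt (t - s)) integrable_on Ipi"
      by (intro integrable_continuous_real continuous_intros)
    fix x :: real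
    have "(sin x)\<^sup>2 \<le> 1" using sin_cos_squared_add[of x] zero_le_power2[of "cos x"] by linarith
    then have "(t - s) * (sin x)\<^sup>2 \<le> t - s" using assms by (simp add: mult_left_le)
    then have "rad t ?a x \<le> sqrt ((?a\<^sup>2 + s * (sin x)\<^sup>2) + (t - s))"
      unfolding rad_def by (intro real_sqrt_le_mono) (simp add: algebra_simps)
    also have "\<dots> \<le> rad s ?a x + sqrt (t - s)"
      unfolding rad_def using assms by (intro sqrt_add_le_add_sqrt) auto
    finally show "rad t ?a x \<le> rad s ?a x + sqrt (t - s)" .
  qed
  also have "\<dots> = integral Ipi (rad s ?a) + 2 * pi * sqrt (t - s)"
    by (subst integral_add[OF rad_integrable]) (auto intro: integrable_const_ivl)
  finally have "excess t \<le> 2 * integral Ipi (rad s ?a) - 2 * pi * ?a\<^sup>2 + 4 * pi * sqrt (t - s)"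
    by (simp add: excess_def)
  with excess_ge[OF assms(1) a] show ?thesis by simp
qed

lemma excess_continuous: "continuous_on {0<..} excess"
proof (rule continuous_at_imp_continuous_on, rule ballI)
  fix s :: real assume "s \<in> {0<..}"
  then have s: "s > 0" by simp
  have "((\<lambda>t. excess s + 4 * pi * sqrt \<bar>t - s\<bar>) \<longlongrightarrow> excess s + 4 * pi * sqrt \<bar>s - s\<bar>) (at s)"
    "((\<lambda>t. excess s - 4 * pi * sqrt \<bar>t - s\<bar>) \<longlongrightarrow> excess s - 4 * pi * sqrt \<bar>s - s\<bar>) (at s)"
    by (intro tendsto_intros)+
  then have lim: "((\<lambda>t. excess s + 4 * pi * sqrt \<bar>t - s\<bar>) \<longlongrightarrow> excess s) (at s)"
    "((\<lambda>t. excess s - 4 * pi * sqrt \<bar>t - s\<bar>) \<longlongrightarrow> excess s) (at s)"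
    by simp_all
  have ev: "\<forall>\<^sub>F t in at s. excess t \<le> excess s + 4 * pi * sqrt \<bar>t - s\<bar>
      \<and> excess s - 4 * pi * sqrt \<bar>t - s\<bar> \<le> excess t"
  proof -
    have "\<forall>\<^sub>F t in at s. t \<in> {0<..}"
      using s by (intro eventually_at_in_open') auto
    then show ?thesis
    proof (rule eventually_mono)
      fix t :: real assume "t \<in> {0<..}"
      then have t: "t > 0" by simp
      have nn: "0 \<le> 4 * pi * sqrt \<bar>t - s\<bar>" by simp
      show "excess t \<le> excess s + 4 * pi * sqrt \<bar>t - s\<bar> \<and> excess s - 4 * pi * sqrt \<bar>t - s\<bar> \<le> excess t"
      proof (cases t s rule: linorder_cases)
        case less
        then show ?thesis
          using excess_modulus[OF t, of s] excess_strict_mono[OF t less] nn by (auto simp: abs_if)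
      next
        case greater
        then show ?thesis
          using excess_modulus[OF s, of t] excess_strict_mono[OF s greater] nn by (auto simp: abs_if)
      qed simp
    qed
  qed
  have "(excess \<longlongrightarrow> excess s) (at s)"
  proof (rule tendsto_sandwich[OF _ _ lim(2) lim(1)])
    show "\<forall>\<^sub>F t in at s. excess s - 4 * pi * sqrt \<bar>t - s\<bar> \<le> excess t"
      using ev by (rule eventually_mono) blast
    show "\<forall>\<^sub>F t in at s. excess t \<le> excess s + 4 * pi * sqrt \<bar>t - s\<bar>"
      using ev by (rule eventually_mono) blast
  qed
  then show "isCont excess s" by (simp add: isCont_def)
qed

text \<open>Pointwise r + 1/r \<ge> 2, and 1/r has integral 2 pi. Equality of the integrals would
  force r = 1 on the whole interval, but r differs at 0 and pi/2.\<close>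

lemma rad_integral_alpha_gt:
  assumes k2: "k2 > 0"
  shows "2 * pi < integral Ipi (rad k2 (alpha k2))"
proof (rule ccontr)
  let ?r = "rad k2 (alpha k2)"
  assume "\<not> 2 * pi < integral Ipi ?r"
  note a = alpha[OF k2]
  have r: "?r x > 0" for x by (rule rad_pos[OF k2 a(1)])
  have hi: "((\<lambda>x. ?r x + 1 / ?r x - 2) has_integral integral Ipi ?r + 2 * pi - integral Ipi (\<lambda>x. 2)) Ipi"
    unfolding a(2)[symmetric]
    by (intro has_integral_add has_integral_diff integrable_integral rad_integrable integrable_const_ivl
        integrable_continuous_real inverse_rad_continuous k2 a)
  have eq: "?r x + 1 / ?r x - 2 = (?r x - 1)\<^sup>2 / ?r x" for x
    using r[of x] by (simp add: field_simps power2_eq_square)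
  have nn: "0 \<le> ?r x + 1 / ?r x - 2" for x
    unfolding eq using r[of x] by (intro divide_nonneg_pos) auto
  have "integral Ipi (\<lambda>x. ?r x + 1 / ?r x - 2) = 0"
    using \<open>\<not> 2 * pi < integral Ipi ?r\<close> integral_unique[OF hi]
      integral_nonneg[of "\<lambda>x. ?r x + 1 / ?r x - 2" Ipi] hi nn by auto
  moreover have "continuous_on Ipi (\<lambda>x. ?r x + 1 / ?r x - 2)"
    by (intro continuous_intros inverse_rad_continuous k2 a)
  ultimately have 0: "?r x + 1 / ?r x - 2 = 0" if "x \<in> Ipi" for x
    using integral_eq_0_iff[of "- pi" pi "\<lambda>x. ?r x + 1 / ?r x - 2"] nn that by auto
  have one: "?r x = 1" if "x \<in> Ipi" for x
    using 0[OF that] r[of x] unfolding eq by simp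
  have "?r 0 = 1" "?r (pi / 2) = 1" by (rule one; simp)+
  then have "(?r 0)\<^sup>2 = (?r (pi / 2))\<^sup>2" by simp
  then show False unfolding rad_square[OF k2 a(1)] using k2 by simp
qed

section \<open>Energy bounds for each degree\<close>

lemma phase_Fen_alpha:
  assumes k2: "k2 > 0" and m: "phase m \<theta> g k"
  shows "Fen k2 m = 2 * pi + 4 * pi * of_int k - (2 * of_int k + 2) * integral Ipi (rad k2 (alpha k2)) + excess k2
       + integral Ipi (\<lambda>t. (g t + rad k2 (alpha k2) (\<theta> t))\<^sup>2)"
  unfolding phase_Fen_square(2)[OF k2 alpha(1)[OF k2] m] by (simp add: excess_def algebra_simps)

lemma phase_square_integral_nonneg:
  assumes k2: "k2 > 0" and m: "phase m \<theta> g k"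
  shows "0 \<le> integral Ipi (\<lambda>t. (g t + rad k2 (alpha k2) (\<theta> t))\<^sup>2)"
  using phase_Fen_square(1)[OF k2 alpha(1)[OF k2] m]
  by (intro integral_nonneg) (auto simp: absolutely_integrable_on_def)

text \<open>The surplus over the degree-zero bound is at least deg m * (4 pi - 2 \<integral> r), a
  product of two negative factors.\<close>

lemma Fen_deg_neg:
  assumes k2: "k2 > 0" and m: "H1S1 m" "deg m < 0"
  shows "Fen k2 m > - 2 * pi + excess k2"
proof -
  obtain \<theta> g where p: "phase m \<theta> g (deg m - 1)" using H1S1_phase[OF m(1)] .
  have "real_of_int (deg m) < 0" using m(2) by simp
  then have "0 < real_of_int (deg m) * (4 * pi - 2 * integral Ipi (rad k2 (alpha k2)))"
    using rad_integral_alpha_gt[OF k2] by (intro mult_neg_neg) auto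
  then show ?thesis
    using phase_Fen_alpha[OF k2 p] phase_square_integral_nonneg[OF k2 p]
    by (simp add: algebra_simps)
qed

lemma Fen_deg_zero:
  assumes k2: "k2 > 0" and m: "H1S1 m" "deg m = 0"
  shows "Fen k2 m \<ge> - 2 * pi + excess k2"
proof -
  obtain \<theta> g where p: "phase m \<theta> g (deg m - 1)" using H1S1_phase[OF m(1)] .
  show ?thesis
    using phase_Fen_alpha[OF k2 p] phase_square_integral_nonneg[OF k2 p] m(2) by simp
qed

lemma Fen_phase_ge:
  assumes k2: "k2 > 0" and m: "phase m \<theta> g k"
  shows "Fen k2 m \<ge> 2 * pi + 4 * pi * of_int k"
proof -
  have "(\<lambda>t. (sin (\<theta> t))\<^sup>2) integrable_on Ipi"
    by (intro integrable_continuous_real continuous_intros weak_deriv_continuous[OF phaseD(1)[OF m]])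
  then have "0 \<le> k2 * integral Ipi (\<lambda>t. (sin (\<theta> t))\<^sup>2)"
    using k2 by (intro mult_nonneg_nonneg integral_nonneg) auto
  moreover have "0 \<le> integral Ipi (\<lambda>t. (g t)\<^sup>2)"
    by (intro integral_nonneg phaseD(2)[OF m]) auto
  ultimately show ?thesis using phase_Fen[OF m, of k2] by simp
qed

lemma Fen_deg_ge_one:
  assumes k2: "k2 > 0" and m: "H1S1 m"
  shows "deg m = 1 \<Longrightarrow> Fen k2 m \<ge> 2 * pi" and "deg m > 1 \<Longrightarrow> Fen k2 m > 2 * pi"
proof -
  obtain \<theta> g where p: "phase m \<theta> g (deg m - 1)" using H1S1_phase[OF m(1)] .
  note ge = Fen_phase_ge[OF k2 p]
  show "deg m = 1 \<Longrightarrow> Fen k2 m \<ge> 2 * pi" using ge by simp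
  assume "deg m > 1"
  then have "0 < 4 * pi * real_of_int (deg m - 1)" by simp
  then show "Fen k2 m > 2 * pi" using ge by simp
qed

section \<open>Numerical bounds for the threshold\<close>

text \<open>The mean of the k-th power of a cosine over a full period, by Wallis' recursion, so that
  it evaluates to a rational number.\<close>

fun cos_moment :: "nat \<Rightarrow> real" where
  "cos_moment 0 = 1"
| "cos_moment (Suc 0) = 0"
| "cos_moment (Suc (Suc k)) = (real k + 1) / (real k + 2) * cos_moment k"

text \<open>Integration by parts in disguise: cos(2x)^(k+1) sin(2x) / 2 vanishes at both ends, and
  its derivative is (k + 2) cos(2x)^(k+2) - (k + 1) cos(2x)^k.\<close>

lemma cos_moment_integral:
  "integral Ipi (\<lambda>x. cos (2 * x) ^ k) = 2 * pi * cos_moment k"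
proof (induction k rule: cos_moment.induct)
  case 2
  have "((\<lambda>x. cos (2 * x)) has_integral sin (2 * pi) / 2 - sin (2 * - pi) / 2) Ipi"
    by (rule fundamental_theorem_of_calculus)
       (auto intro!: derivative_eq_intros simp flip: has_real_derivative_iff_has_vector_derivative)
  then show ?case by (simp add: integral_unique)
next
  case (3 k)
  have int: "(\<lambda>x. cos (2 * x) ^ j) integrable_on Ipi" for j
    by (intro integrable_continuous_real continuous_intros)
  have "((\<lambda>x. (real k + 2) * cos (2 * x) ^ Suc (Suc k) - (real k + 1) * cos (2 * x) ^ k) has_integral
     (cos (2 * pi) ^ Suc k * sin (2 * pi) / 2 - cos (2 * - pi) ^ Suc k * sin (2 * - pi) / 2)) Ipi"
  proof (rule fundamental_theorem_of_calculus)
    fix x :: real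
    have s: "sin (2 * x) * sin (2 * x) = 1 - cos (2 * x) * cos (2 * x)"
      using sin_cos_squared_add3[of "2 * x"] by linarith
    have dc: "((\<lambda>x. cos (2 * x)) has_real_derivative - sin (2 * x) * 2) (at x within Ipi)"
      and ds: "((\<lambda>x. sin (2 * x)) has_real_derivative cos (2 * x) * 2) (at x within Ipi)"
      by (auto intro!: derivative_eq_intros)
    note DERIV_cdivide[OF DERIV_mult[OF DERIV_power_Suc[OF dc, of k] ds], of 2]
    moreover have "((1 + real k) * (- sin (2 * x) * 2 * cos (2 * x) ^ k) * sin (2 * x)
         + cos (2 * x) * 2 * cos (2 * x) ^ Suc k) / 2
       = cos (2 * x) ^ Suc (Suc k) - (1 + real k) * cos (2 * x) ^ k * (sin (2 * x) * sin (2 * x))"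
      by (simp add: field_simps)
    moreover have "\<dots> = (real k + 2) * cos (2 * x) ^ Suc (Suc k) - (real k + 1) * cos (2 * x) ^ k"
      unfolding s by (simp add: algebra_simps)
    ultimately show "((\<lambda>x. cos (2 * x) ^ Suc k * sin (2 * x) / 2) has_vector_derivative
       (real k + 2) * cos (2 * x) ^ Suc (Suc k) - (real k + 1) * cos (2 * x) ^ k) (at x within Ipi)"
      by (simp only: has_real_derivative_iff_has_vector_derivative)
  qed simp
  then have "integral Ipi (\<lambda>x. (real k + 2) * cos (2 * x) ^ Suc (Suc k) - (real k + 1) * cos (2 * x) ^ k) = 0"
    by (simp add: integral_unique)
  then have "(real k + 2) * integral Ipi (\<lambda>x. cos (2 * x) ^ Suc (Suc k))
      = (real k + 1) * integral Ipi (\<lambda>x. cos (2 * x) ^ k)"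
    by (subst (asm) integral_diff) (intro integrable_on_mult_right int | simp only: integral_mult_right)+
  then show ?case using 3 by (simp add: field_simps)
qed simp

text \<open>The extra power \<open>k\<close> records how many coefficients have been peeled off, so
  that simplification can compute the mean of an explicit polynomial coefficient by
  coefficient.\<close>

definition cos_mean :: "nat \<Rightarrow> real poly \<Rightarrow> real" where
  "cos_mean k p = integral Ipi (\<lambda>x. poly p (cos (2 * x)) * cos (2 * x) ^ k) / (2 * pi)"

lemma poly_cos_integrable: "(\<lambda>x. poly p (cos (2 * x)) * cos (2 * x) ^ k) integrable_on {a..b::real}"
  by (intro integrable_continuous_real continuous_intros)

lemma cos_mean_0: "cos_mean k 0 = 0"
  by (simp add: cos_mean_def)

lemma cos_mean_pCons: "cos_mean k (pCons a p) = a * cos_moment k + cos_mean (Suc k) p"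
proof -
  have int: "(\<lambda>x. cos (2 * x) ^ j) integrable_on Ipi" for j
    by (intro integrable_continuous_real continuous_intros)
  have "integral Ipi (\<lambda>x. poly (pCons a p) (cos (2 * x)) * cos (2 * x) ^ k)
     = integral Ipi (\<lambda>x. a * cos (2 * x) ^ k + poly p (cos (2 * x)) * cos (2 * x) ^ Suc k)"
    by (rule integral_cong) (simp add: algebra_simps)
  also have "\<dots> = a * (2 * pi * cos_moment k) + integral Ipi (\<lambda>x. poly p (cos (2 * x)) * cos (2 * x) ^ Suc k)"
    by (subst integral_add) (intro integrable_on_mult_right int poly_cos_integrable
        | simp only: integral_mult_right cos_moment_integral)+
  finally show ?thesis by (simp add: cos_mean_def field_simps)
qed

lemma poly_cos_has_integral:
  "((\<lambda>x. poly p (cos (2 * x))) has_integral 2 * pi * cos_mean 0 p) Ipi"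
  using integrable_integral[OF poly_cos_integrable[of p 0 "- pi" pi]] by (simp add: cos_mean_def)

text \<open>Newton's iteration for the inverse square root never overshoots:
  $y (3 - w y^2) / 2 \le w^{-1/2}$ for $y \ge 0$.\<close>

lemma rad_integral_lower:
  fixes p :: "real poly"
  assumes k2: "k2 > 0" and b: "b > 0" and p: "\<And>c. - 1 \<le> c \<Longrightarrow> c \<le> 1 \<Longrightarrow> poly p c \<ge> 0"
    and W: "W = [:b\<^sup>2 + k2 / 2, - (k2 / 2):]"
  shows "pi * cos_mean 0 (W * p * ([:3:] - W * p * p)) \<le> integral Ipi (rad k2 b)"
proof -
  have "2 * pi * cos_mean 0 (W * p * ([:3:] - W * p * p)) \<le> integral Ipi (\<lambda>x. 2 * rad k2 b x)"
  proof (rule has_integral_le[OF poly_cos_has_integral integrable_integral])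
    show "(\<lambda>x. 2 * rad k2 b x) integrable_on Ipi"
      by (intro integrable_continuous_real continuous_intros)
    fix x :: real
    define r y where "r = rad k2 b x" and "y = poly p (cos (2 * x))"
    have r: "r > 0" unfolding r_def by (rule rad_pos[OF k2 b])
    have y: "y \<ge> 0" unfolding y_def by (rule p) auto
    have sin2: "(sin x)\<^sup>2 = (1 - cos (2 * x)) / 2"
      by (simp add: cos_double_sin)
    have "r\<^sup>2 = poly W (cos (2 * x))"
      unfolding r_def rad_square[OF k2 b] W sin2 by (simp add: field_simps)
    then have "poly (W * p * ([:3:] - W * p * p)) (cos (2 * x)) = r\<^sup>2 * y * (3 - r\<^sup>2 * y * y)"
      unfolding y_def by simp
    also have "\<dots> = r * (3 * (r * y) - (r * y) ^ 3)"
      by (simp add: power2_eq_square power3_eq_cube algebra_simps)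
    \<comment> \<open>The factorisation around r y = 1 shows both the sign of the error and that it
      is quadratic in the error of \<open>p\<close>.\<close>
    also have "3 * (r * y) - (r * y) ^ 3 = 2 - (r * y - 1)\<^sup>2 * (r * y + 2)"
      by (simp add: power2_eq_square power3_eq_cube algebra_simps)
    also have "r * \<dots> \<le> r * 2"
      using r y by (intro mult_left_mono) auto
    finally show "poly (W * p * ([:3:] - W * p * p)) (cos (2 * x)) \<le> 2 * rad k2 b x"
      by (simp add: r_def mult.commute)
  qed
  then show ?thesis by simp
qed

text \<open>Dually, $2 \sqrt{w} \le w p + 1/p$ for every positive weight $p$, where $p$ of mean one makes the
  bound insensitive to $\alpha_\kappa$; $1/p$ is in turn bounded through an approximate inverse $z$.\<close>

lemma excess_upper:
  fixes p z :: "real poly"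
  assumes k2: "k2 > 0" and C: "C > 0" and p: "\<And>c. - 1 \<le> c \<Longrightarrow> c \<le> 1 \<Longrightarrow> poly p c \<ge> 1 / C"
    and mean: "cos_mean 0 p = 1"
  shows "excess k2 \<le> 2 * pi * cos_mean 0 ([:k2 / 2, - (k2 / 2):] * p + z * ([:2:] - z * p)
            + smult C (([:1:] - z * p) * ([:1:] - z * p)))"
    (is "_ \<le> 2 * pi * cos_mean 0 ?q")
proof -
  let ?a = "alpha k2"
  note a = alpha(1)[OF k2]
  have "((\<lambda>x. ?a\<^sup>2 * poly p (cos (2 * x)) + poly ?q (cos (2 * x))) has_integral
     ?a\<^sup>2 * (2 * pi * cos_mean 0 p) + 2 * pi * cos_mean 0 ?q) Ipi"
    by (intro has_integral_add has_integral_mult_right poly_cos_has_integral)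
  then have hi: "((\<lambda>x. ?a\<^sup>2 * poly p (cos (2 * x)) + poly ?q (cos (2 * x))) has_integral
     2 * pi * ?a\<^sup>2 + 2 * pi * cos_mean 0 ?q) Ipi"
    unfolding mean by (simp add: mult.commute mult.left_commute)
  have "integral Ipi (\<lambda>x. 2 * rad k2 ?a x) \<le> 2 * pi * ?a\<^sup>2 + 2 * pi * cos_mean 0 ?q"
  proof (rule has_integral_le[OF integrable_integral hi])
    show "(\<lambda>x. 2 * rad k2 ?a x) integrable_on Ipi"
      by (intro integrable_continuous_real continuous_intros)
    fix x :: real
    define y t where "y = poly p (cos (2 * x))" and "t = poly z (cos (2 * x))"
    have y: "y \<ge> 1 / C" unfolding y_def by (rule p) auto
    then have y0: "y > 0" using C by (meson less_le_trans zero_less_divide_1_iff)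
    have "2 * rad k2 ?a x \<le> (?a\<^sup>2 + k2 * (sin x)\<^sup>2) * y + 1 / y"
      using two_rad_le[OF k2 a, of "1 / y" x] y0 by simp
    also have "1 / y \<le> t * (2 - t * y) + (1 - t * y)\<^sup>2 * C"
    proof -
      \<comment> \<open>An exact identity: one Newton step for the reciprocal plus a remainder, in
        which only the last factor 1 / y is replaced by its bound \<open>C\<close>.\<close>
      have "1 / y = t * (2 - t * y) + (1 - t * y)\<^sup>2 * (1 / y)"
        using y0 by (simp add: field_simps power2_eq_square)
      also have "(1 - t * y)\<^sup>2 * (1 / y) \<le> (1 - t * y)\<^sup>2 * C"
        by (intro mult_left_mono) (use y y0 C in \<open>simp_all add: field_simps\<close>)
      finally show ?thesis by simp
    qed
    also have "(sin x)\<^sup>2 = (1 - cos (2 * x)) / 2"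
      by (simp add: cos_double_sin)
    also have "(?a\<^sup>2 + k2 * ((1 - cos (2 * x)) / 2)) * y + (t * (2 - t * y) + (1 - t * y)\<^sup>2 * C)
       = ?a\<^sup>2 * poly p (cos (2 * x)) + poly ?q (cos (2 * x))"
    proof -
      have "poly ?q (cos (2 * x)) = (k2 / 2 - k2 / 2 * cos (2 * x)) * y + t * (2 - t * y)
         + C * ((1 - t * y) * (1 - t * y))"
        unfolding y_def t_def by (simp add: left_diff_distrib)
      then show ?thesis
        unfolding y_def[symmetric] by (simp add: power2_eq_square field_simps)
    qed
    finally show "2 * rad k2 ?a x \<le> ?a\<^sup>2 * poly p (cos (2 * x)) + poly ?q (cos (2 * x))" by simp
  qed
  then show ?thesis by (simp add: excess_def)
qed

text \<open>Below, $p$ is a rounded least-squares approximation of $1/\sqrt{w}$ and $z$ one of $1/p$, as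
  polynomials in $\cos 2x$; the errors enter quadratically.\<close>

lemma excess_lower_231743: "4 * pi < excess (231743 / 100000)"
proof -
  \<comment> \<open>An approximation of \<open>alpha\<close> at this value of \<kappa>^2. Since
    \<open>alpha\<close> is the maximising parameter, the error costs only second order.\<close>
  define b :: real where "b = sqrt (28572 / 100000)"
  have b: "b > 0" "b\<^sup>2 = 28572 / 100000" by (auto simp: b_def)
  define p :: "real poly" where
    "p = smult (1 / 1000) [:832, 330, 201, 184, 115, -98, -48, 208, 144:]"
  define W :: "real poly" where "W = [:288887 / 200000, - 231743 / 200000:]"
  have "pi * cos_mean 0 (W * p * ([:3:] - W * p * p)) \<le> integral Ipi (rad (231743 / 100000) b)"
  proof (rule rad_integral_lower)
    fix c :: real assume c: "- 1 \<le> c" "c \<le> 1"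
    \<comment> \<open>The grouped terms and c^8 are nonnegative on [-1, 1]; the rest is at least 832
      - 330 - 48 - 208 > 0.\<close>
    have "1000 * poly p c = 832 + 330 * c + c ^ 2 * (201 + 184 * c) + c ^ 4 * (115 - 98 * c)
        - 48 * c ^ 6 + 208 * c ^ 7 + 144 * c ^ 8"
      by (simp add: p_def eval_nat_numeral algebra_simps)
    moreover have "0 \<le> c ^ 2 * (201 + 184 * c)" "0 \<le> c ^ 4 * (115 - 98 * c)" "0 \<le> c ^ 8"
      using c by auto
    moreover have "c ^ 6 \<le> 1" "- 1 \<le> c ^ 7"
      using c power_le_one[of "\<bar>c\<bar>" 6] power_le_one[of "\<bar>c\<bar>" 7] by (auto simp: abs_le_iff simp flip: power_abs)
    ultimately show "0 \<le> poly p c" using c by linarith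
  qed (use b in \<open>auto simp: W_def\<close>)
  \<comment> \<open>The target is 2 + b^2, because 2 \<integral> r_b - 2 pi b^2 exceeds 4 pi exactly
    when \<integral> r_b exceeds pi (2 + b^2).\<close>
  moreover have mean: "cos_mean 0 (W * p * ([:3:] - W * p * p)) > 2 + 28572 / 100000"
    unfolding p_def W_def by (simp add: cos_mean_pCons cos_mean_0)
  have "pi * cos_mean 0 (W * p * ([:3:] - W * p * p)) > pi * (2 + 28572 / 100000)"
    by (rule mult_strict_left_mono[OF mean pi_gt_zero])
  ultimately have "pi * (2 + 28572 / 100000) < integral Ipi (rad (231743 / 100000) b)"
    by (rule less_le_trans[rotated])
  then have "4 * pi < 2 * integral Ipi (rad (231743 / 100000) b) - 2 * pi * b\<^sup>2"
    unfolding b(2) by (simp add: algebra_simps)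
  also have "\<dots> \<le> excess (231743 / 100000)"
    by (rule excess_ge) (use b in auto)
  finally show ?thesis .
qed

lemma excess_upper_231741: "excess (231741 / 100000) < 4 * pi"
proof -
  \<comment> \<open>The coefficients are tuned to mean exactly one: 13299 + 3664 / 2 - 656 * 3/8 +
    3568 * 5/16 = 16000.\<close>
  define p :: "real poly" where
    "p = smult (1 / 16000) [:13299, 5360, 3664, 2288, -656, -144, 3568, 2464:]"
  define z :: "real poly" where "z = smult (1 / 1000) [:1202, -484, -88, -28, -39, -27:]"
  define q where "q = [:231741 / 100000 / 2, - (231741 / 100000 / 2):] * p + z * ([:2:] - z * p)
            + smult (5 / 2) (([:1:] - z * p) * ([:1:] - z * p))"
  have "excess (231741 / 100000) \<le> 2 * pi * cos_mean 0 q"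
    unfolding q_def
  proof (rule excess_upper)
    fix c :: real assume c: "- 1 \<le> c" "c \<le> 1"
    \<comment> \<open>Dropping the two nonnegative groups leaves at least 13299 - 5360 - 656 - 144 =
      7139, above 6400 = 16000 * 2/5; this is the source of \<open>C = 5/2\<close>.\<close>
    have "16000 * poly p c = 13299 + 5360 * c + c ^ 2 * (3664 + 2288 * c) - 656 * c ^ 4 - 144 * c ^ 5
        + c ^ 6 * (3568 + 2464 * c)"
      by (simp add: p_def eval_nat_numeral algebra_simps)
    moreover have "0 \<le> c ^ 2 * (3664 + 2288 * c)" "0 \<le> c ^ 6 * (3568 + 2464 * c)"
      using c by auto
    moreover have "c ^ 4 \<le> 1" "c ^ 5 \<le> 1"
      using c power_le_one[of "\<bar>c\<bar>" 4] power_le_one[of "\<bar>c\<bar>" 5] by (auto simp: abs_le_iff simp flip: power_abs)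
    ultimately have "2 / 5 \<le> poly p c" using c by linarith
    then show "1 / (5 / 2) \<le> poly p c" by simp
  next
    show "cos_mean 0 p = 1" unfolding p_def by (simp add: cos_mean_pCons cos_mean_0)
  qed auto
  also have "cos_mean 0 q < 2"
    unfolding q_def p_def z_def by (simp add: cos_mean_pCons cos_mean_0)
  finally show ?thesis by simp
qed

section \<open>Minimizers in the classes of degree one and zero\<close>

lemma phase_cong:
  assumes "phase m \<theta> g k" "\<And>t. t \<in> Ipi \<Longrightarrow> m' t = m t"
  shows "phase m' \<theta> g k"
  using assms unfolding phase_def by simp

text \<open>Serves with \<open>c = 0\<close> to freeze the phase at degree one, and with
  \<open>c = - alpha\<close> to integrate the equation for \<open>Fk\<close> of the phase at degree
  zero.\<close>

lemma weak_deriv_zero_imp_const: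
  fixes F :: "real \<Rightarrow> real"
  assumes "weak_deriv F g" and N: "negligible N" "\<And>t. t \<in> Ipi - N \<Longrightarrow> g t = c" and t: "t \<in> Ipi"
  shows "F t = F (- pi) + c * (t + pi)"
proof -
  have "weak_deriv F (\<lambda>_. c)"
    by (rule weak_deriv_cong[OF assms(1) refl N(1)]) (simp add: N(2))
  from weak_derivD(3)[OF this t] t show ?thesis by (simp add: algebra_simps)
qed

lemma phase_nvec_const:
  assumes "sin c = 0"
  shows "phase (\<lambda>t. nvec (t + c)) (\<lambda>_. c) (\<lambda>_. 0) 0" "Fen k2 (\<lambda>t. nvec (t + c)) = 2 * pi"
proof -
  show "phase (\<lambda>t. nvec (t + c)) (\<lambda>_. c) (\<lambda>_. 0) 0"
    unfolding phase_def by (simp add: weak_deriv_const integrable_0)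
  from phase_Fen[OF this, of k2] show "Fen k2 (\<lambda>t. nvec (t + c)) = 2 * pi"
    using assms by simp
qed

lemma nvec_shift: "(\<lambda>t. nvec (t + 0)) = nvec" "(\<lambda>t. nvec (t + pi)) = (\<lambda>t. - nvec t)"
  by (auto simp: nvec_add)

lemma Fen_nvec: "Fen k2 nvec = 2 * pi" "Fen k2 (\<lambda>t. - nvec t) = 2 * pi"
  using phase_nvec_const(2)[of 0 k2] phase_nvec_const(2)[of pi k2] unfolding nvec_shift by simp_all

lemma phase_nvec: "phase nvec (\<lambda>_. 0) (\<lambda>_. 0) 0" "phase (\<lambda>t. - nvec t) (\<lambda>_. pi) (\<lambda>_. 0) 0"
  using phase_nvec_const(1)[of 0] phase_nvec_const(1)[of pi] unfolding nvec_shift by simp_all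

lemma H1S1_nvec: "H1S1 nvec" "H1S1 (\<lambda>t. - nvec t)"
  using phase_H1S1 phase_nvec by blast+

lemma deg_nvec: "deg nvec = 1" "deg (\<lambda>t. - nvec t) = 1"
  using phase_deg[OF phase_nvec(1)] phase_deg[OF phase_nvec(2)] by simp_all

text \<open>At energy 2 pi both nonnegative integrals vanish, so the phase is constant with zero
  sine. Equality is asserted on \<open>Ipi\<close> only, as the class does not constrain values
  elsewhere.\<close>

lemma min_in_deg_one_iff:
  assumes k2: "k2 > 0"
  shows "min_in_deg k2 1 m \<longleftrightarrow> H1S1 m \<and> ((\<forall>t\<in>Ipi. m t = nvec t) \<or> (\<forall>t\<in>Ipi. m t = - nvec t))"
proof
  assume m: "min_in_deg k2 1 m"
  then have H: "H1S1 m" and d: "deg m = 1" and le: "Fen k2 m \<le> 2 * pi"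
    unfolding min_in_deg_def using H1S1_nvec(1) deg_nvec(1) Fen_nvec(1)[of k2] by auto
  obtain \<theta> g where p: "phase m \<theta> g 0"
    using H1S1_phase[OF H] d by auto
  note g = weak_derivD(1)[OF phaseD(1)[OF p]]
  have \<theta>c: "continuous_on Ipi (\<lambda>t. (sin (\<theta> t))\<^sup>2)"
    by (intro continuous_intros weak_deriv_continuous[OF phaseD(1)[OF p]])
  have nn: "0 \<le> integral Ipi (\<lambda>t. (sin (\<theta> t))\<^sup>2)" "0 \<le> integral Ipi (\<lambda>t. (g t)\<^sup>2)"
    by (intro integral_nonneg integrable_continuous_real \<theta>c phaseD(2)[OF p]; simp)+
  have "integral Ipi (\<lambda>t. (g t)\<^sup>2) + k2 * integral Ipi (\<lambda>t. (sin (\<theta> t))\<^sup>2) \<le> 0"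
    using phase_Fen[OF p, of k2] le by simp
  moreover have "0 \<le> k2 * integral Ipi (\<lambda>t. (sin (\<theta> t))\<^sup>2)" using nn(1) k2 by simp
  ultimately have g0: "integral Ipi (\<lambda>t. (g t)\<^sup>2) = 0" and "k2 * integral Ipi (\<lambda>t. (sin (\<theta> t))\<^sup>2) = 0"
    using nn(2) by linarith+
  then have "integral Ipi (\<lambda>t. (sin (\<theta> t))\<^sup>2) = 0" using k2 by simp
  then have "\<forall>t\<in>Ipi. (sin (\<theta> t))\<^sup>2 = 0"
    using integral_eq_0_iff[OF \<theta>c] by simp
  then have sin0: "sin (\<theta> (- pi)) = 0" by simp
  obtain N where N: "negligible N" "\<And>t. t \<in> Ipi - N \<Longrightarrow> (g t)\<^sup>2 = 0"
    by (rule integral_nonneg_eq_0_imp_negligible[OF _ _ _ g0])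
       (use phaseD(2)[OF p] in \<open>auto intro: nonnegative_absolutely_integrable_1\<close>)
  have \<theta>0: "\<theta> t = \<theta> (- pi)" if "t \<in> Ipi" for t
    using weak_deriv_zero_imp_const[OF phaseD(1)[OF p] N(1) _ that, of 0] N(2) by simp
  have m: "m t = cos (\<theta> (- pi)) *\<^sub>R nvec t" if "t \<in> Ipi" for t
  proof -
    have "m t = nvec (t + \<theta> (- pi))"
      by (simp only: phaseD(3)[OF p that] \<theta>0[OF that])
    then show ?thesis by (simp add: nvec_add sin0)
  qed
  have "cos (\<theta> (- pi)) = 1 \<or> cos (\<theta> (- pi)) = - 1"
    using sin_zero_abs_cos_one[OF sin0] by linarith
  then show "H1S1 m \<and> ((\<forall>t\<in>Ipi. m t = nvec t) \<or> (\<forall>t\<in>Ipi. m t = - nvec t))"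
    using H m by auto
next
  assume "H1S1 m \<and> ((\<forall>t\<in>Ipi. m t = nvec t) \<or> (\<forall>t\<in>Ipi. m t = - nvec t))"
  then have H: "H1S1 m" and "(\<forall>t\<in>Ipi. m t = nvec t) \<or> (\<forall>t\<in>Ipi. m t = - nvec t)" by auto
  then obtain c where c: "sin c = 0" "phase m (\<lambda>_. c) (\<lambda>_. 0) 0"
    using phase_cong[OF phase_nvec(1), of m] phase_cong[OF phase_nvec(2), of m]
    by (metis sin_pi sin_zero)
  then have "Fen k2 m = 2 * pi" "deg m = 1"
    using phase_Fen[OF c(2), of k2] phase_deg[OF c(2)] by simp_all
  then show "min_in_deg k2 1 m"
    unfolding min_in_deg_def using H Fen_deg_ge_one(1)[OF k2] by simp
qed

text \<open>As t crosses an interval of length 2 pi, the argument of \<open>am\<close> drops by 2 pi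
  \<open>alpha\<close>, exactly one period; hence the relative winding -1 and degree zero.\<close>

lemma phase_mzero:
  assumes k2: "k2 > 0"
  shows "phase (mzero k2 b) (\<lambda>t. am k2 (- alpha k2 * t + b))
     (\<lambda>t. - rad k2 (alpha k2) (am k2 (- alpha k2 * t + b))) (- 1)"
  unfolding phase_def
proof (intro conjI ballI)
  let ?\<theta> = "\<lambda>t. am k2 (- alpha k2 * t + b)"
  have deriv: "(?\<theta> has_real_derivative - rad k2 (alpha k2) (?\<theta> t)) (at t)" for t
  proof -
    have "((\<lambda>t. - alpha k2 * t + b) has_real_derivative - alpha k2) (at t)"
      by (auto intro!: derivative_eq_intros)
    from DERIV_chain2[OF am_deriv[OF k2] this] show ?thesis
      using alpha(1)[OF k2] by simp
  qed
  have "continuous_on UNIV ?\<theta>"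
    by (intro continuous_at_imp_continuous_on ballI DERIV_isCont[OF deriv])
  then have rc: "continuous_on Ipi (\<lambda>t. rad k2 (alpha k2) (?\<theta> t))"
    by (intro continuous_on_compose2[OF rad_continuous[of UNIV]]) (auto intro: continuous_on_subset)
  show "weak_deriv ?\<theta> (\<lambda>t. - rad k2 (alpha k2) (?\<theta> t))"
    by (rule weak_deriv_continuous_integrand
        [OF deriv[unfolded has_real_derivative_iff_has_vector_derivative] continuous_on_minus[OF rc]])
  show "(\<lambda>t. (- rad k2 (alpha k2) (?\<theta> t))\<^sup>2) integrable_on Ipi"
    by (intro integrable_continuous_real continuous_intros rc)
  show "mzero k2 b t = nvec (t + ?\<theta> t)" for t
    by (simp add: mzero_def nvec_add Let_def)
  have shift: "- alpha k2 * pi + b = (- alpha k2 * - pi + b) - 2 * pi * alpha k2" by simp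
  have "?\<theta> pi = ?\<theta> (- pi) - 2 * pi"
    unfolding shift by (rule am_minus_period[OF k2])
  then show "?\<theta> pi - ?\<theta> (- pi) = 2 * pi * of_int (- 1)"
    by simp
qed

lemma Fen_mzero_phase:
  assumes k2: "k2 > 0" and m: "\<And>t. t \<in> Ipi \<Longrightarrow> m t = mzero k2 b t"
  shows "H1S1 m" "deg m = 0" "Fen k2 m = - 2 * pi + excess k2"
proof -
  note p = phase_cong[OF phase_mzero[OF k2], OF m]
  show "H1S1 m" "deg m = 0" using phase_H1S1[OF p] phase_deg[OF p] by simp_all
  show "Fen k2 m = - 2 * pi + excess k2" using phase_Fen_alpha[OF k2 p] by simp
qed

lemmas mzero_energy = Fen_mzero_phase[OF _ refl]

lemma min_in_deg_zero_Fen: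
  assumes k2: "k2 > 0" and m: "min_in_deg k2 0 m"
  shows "Fen k2 m = - 2 * pi + excess k2"
proof (rule antisym)
  have "Fen k2 m \<le> Fen k2 (mzero k2 0)"
    using m mzero_energy(1,2)[OF k2, of 0] unfolding min_in_deg_def by blast
  then show "Fen k2 m \<le> - 2 * pi + excess k2" using mzero_energy(3)[OF k2, of 0] by simp
  show "- 2 * pi + excess k2 \<le> Fen k2 m"
    using m Fen_deg_zero[OF k2] unfolding min_in_deg_def by blast
qed

text \<open>Minimality kills the square, leaving \<theta>' = - r(\<theta>) almost everywhere.
  Separation of variables solves it in the weak setting: \<open>Fk\<close> of the phase has constant
  weak derivative - \<open>alpha\<close>, so it is affine, and \<open>am\<close> inverts it.\<close>

lemma min_in_deg_zero_iff:
  assumes k2: "k2 > 0"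
  shows "min_in_deg k2 0 m \<longleftrightarrow> H1S1 m \<and> (\<exists>b. \<forall>t\<in>Ipi. m t = mzero k2 b t)"
proof
  assume m: "min_in_deg k2 0 m"
  then have H: "H1S1 m" and d: "deg m = 0" unfolding min_in_deg_def by auto
  let ?r = "rad k2 (alpha k2)"
  note a = alpha(1)[OF k2]
  obtain \<theta> g where p: "phase m \<theta> g (- 1)"
    using H1S1_phase[OF H] d by auto
  have "integral Ipi (\<lambda>t. (g t + ?r (\<theta> t))\<^sup>2) = 0"
    using phase_Fen_alpha[OF k2 p] min_in_deg_zero_Fen[OF k2 m] by simp
  then obtain N where N: "negligible N" "\<And>t. t \<in> Ipi - N \<Longrightarrow> (g t + ?r (\<theta> t))\<^sup>2 = 0"
    using integral_nonneg_eq_0_imp_negligible[OF phase_Fen_square(1)[OF k2 a p]] by auto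
  have "weak_deriv (\<lambda>t. Fk k2 (\<theta> t)) (\<lambda>t. alpha k2 / ?r (\<theta> t) * g t)"
    by (rule weak_deriv_compose[OF phaseD(1)[OF p] Fk_deriv[OF k2]])
       (rule inverse_rad_continuous[OF k2 a])
  moreover have "alpha k2 / ?r (\<theta> t) * g t = - alpha k2" if "t \<in> Ipi - N" for t
  proof -
    have "g t = - ?r (\<theta> t)" using N(2)[OF that] by simp
    then show ?thesis using rad_pos[OF k2 a, of "\<theta> t"] by simp
  qed
  ultimately have F: "Fk k2 (\<theta> t) = Fk k2 (\<theta> (- pi)) + - alpha k2 * (t + pi)" if "t \<in> Ipi" for t
    using weak_deriv_zero_imp_const[OF _ N(1) _ that] by blast
  define b where "b = Fk k2 (\<theta> (- pi)) - alpha k2 * pi"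
  have "m t = mzero k2 b t" if "t \<in> Ipi" for t
  proof -
    have "Fk k2 (\<theta> t) = - alpha k2 * t + b"
      using F[OF that] by (simp add: b_def algebra_simps)
    then have "\<theta> t = am k2 (- alpha k2 * t + b)" using am_Fk[OF k2] by metis
    then show ?thesis
      using phaseD(3)[OF p that] phaseD(3)[OF phase_mzero[OF k2] that, of b] by simp
  qed
  then show "H1S1 m \<and> (\<exists>b. \<forall>t\<in>Ipi. m t = mzero k2 b t)" using H by blast
next
  assume "H1S1 m \<and> (\<exists>b. \<forall>t\<in>Ipi. m t = mzero k2 b t)"
  then obtain b where "\<And>t. t \<in> Ipi \<Longrightarrow> m t = mzero k2 b t" by blast
  from Fen_mzero_phase[OF k2 this] show "min_in_deg k2 0 m"
    unfolding min_in_deg_def using Fen_deg_zero[OF k2] by auto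
qed

section \<open>Global minimizers\<close>

text \<open>The competitors n and \<open>mzero\<close> cap the energy by 2 pi and by -2 pi +
  \<open>excess\<close>. Degrees above one violate the first cap and negative degrees the second;
  the sign of \<open>excess\<close> - 4 pi decides between the remaining two.\<close>

lemma global_min_deg:
  assumes k2: "k2 > 0" and m: "global_min k2 m"
  shows "deg m \<in> {0, 1}" "excess k2 > 4 * pi \<Longrightarrow> deg m = 1" "excess k2 < 4 * pi \<Longrightarrow> deg m = 0"
proof -
  have H: "H1S1 m" and le: "\<And>m'. H1S1 m' \<Longrightarrow> Fen k2 m \<le> Fen k2 m'"
    using m unfolding global_min_def by auto
  have le1: "Fen k2 m \<le> 2 * pi" using le[OF H1S1_nvec(1)] Fen_nvec by simp
  have le0: "Fen k2 m \<le> - 2 * pi + excess k2"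
    using le[OF mzero_energy(1)[OF k2]] mzero_energy(3)[OF k2] by simp
  have "\<not> deg m < 0" using Fen_deg_neg[OF k2 H] le0 by linarith
  moreover have "\<not> deg m > 1" using Fen_deg_ge_one(2)[OF k2 H] le1 by linarith
  ultimately have "deg m = 0 \<or> deg m = 1" by linarith
  then show "deg m \<in> {0, 1}" by simp
  show "deg m = 1" if "excess k2 > 4 * pi"
    using \<open>deg m = 0 \<or> deg m = 1\<close> Fen_deg_zero[OF k2 H] le1 that by linarith
  show "deg m = 0" if "excess k2 < 4 * pi"
    using \<open>deg m = 0 \<or> deg m = 1\<close> Fen_deg_ge_one(1)[OF k2 H] le0 that by linarith
qed

lemma Fen_ge_at_threshold:
  assumes k2: "k2 > 0" and ex: "excess k2 = 4 * pi" and m: "H1S1 m"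
  shows "2 * pi \<le> Fen k2 m"
proof -
  consider "deg m < 0" | "deg m = 0" | "deg m = 1" | "deg m > 1" by linarith
  then show ?thesis
    using Fen_deg_neg[OF k2 m] Fen_deg_zero[OF k2 m] Fen_deg_ge_one[OF k2 m] ex
    by cases auto
qed

section \<open>Stability\<close>

text \<open>The derivative of the phase $\theta$ solves the linearised equation and has no zero; its
  logarithmic derivative $u$ is periodic and $u' = \kappa^2 \cos 2\theta - u^2$, which turns the
  second variation into $\int (\phi' - u \phi)^2$.\<close>

lemma second_variation_nonneg:
  fixes \<phi> :: "real \<Rightarrow> real"
  assumes k2: "k2 > 0" and \<phi>: "H1per \<phi>"
  shows "0 \<le> integral Ipi (\<lambda>t. (wderiv \<phi> t)\<^sup>2 + k2 * (\<phi> t)\<^sup>2 * cos (2 * am k2 (- alpha k2 * t + b)))"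
proof -
  obtain g0 where g0: "weak_deriv \<phi> g0" "(\<lambda>t. norm (g0 t) ^ 2) integrable_on Ipi" "\<phi> pi = \<phi> (- pi)"
    using \<phi> unfolding H1per_def by blast
  define h where "h = wderiv \<phi>"
  have h: "weak_deriv \<phi> h" unfolding h_def by (rule weak_deriv_wderiv[OF g0(1)])
  \<comment> \<open>\<open>H1per\<close> provides square integrability for some weak derivative; it
    is carried over to the chosen one.\<close>
  obtain N where N: "negligible N" "\<And>t. t \<in> Ipi - N \<Longrightarrow> h t = g0 t"
    using weak_deriv_unique[OF h g0(1)] by blast
  have h2: "(\<lambda>t. (h t)\<^sup>2) integrable_on Ipi"
    by (rule integrable_spike[OF g0(2) N(1)]) (simp add: N(2))
  let ?r = "rad k2 (alpha k2)"
  note a = alpha(1)[OF k2]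
  have r: "?r x > 0" for x by (rule rad_pos[OF k2 a])
  define \<theta> where "\<theta> = (\<lambda>t. am k2 (- alpha k2 * t + b))"
  have \<theta>': "(\<theta> has_real_derivative - ?r (\<theta> t)) (at t)" for t
  proof -
    have "((\<lambda>t. - alpha k2 * t + b) has_real_derivative - alpha k2) (at t)"
      by (auto intro!: derivative_eq_intros)
    from DERIV_chain2[OF am_deriv[OF k2] this] show ?thesis
      unfolding \<theta>_def using a by simp
  qed
  have \<theta>c: "continuous_on S \<theta>" for S
    by (intro continuous_at_imp_continuous_on ballI DERIV_isCont[OF \<theta>'])
  \<comment> \<open>The derivative of \<theta> is -r(\<theta>), whose logarithmic derivative is
    r'(\<theta>) \<theta>' / r(\<theta>) = - r'(\<theta>). \<open>U\<close> is thus - r' as a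
    function of the angle.\<close>
  define U where "U = (\<lambda>x. - (k2 * (sin x * cos x)) / ?r x)"
  have r': "(?r has_real_derivative k2 * (sin x * cos x) / ?r x) (at x)" for x
  proof -
    have "((\<lambda>x. (alpha k2)\<^sup>2 + k2 * (sin x)\<^sup>2) has_real_derivative k2 * (2 * sin x * cos x)) (at x)"
      by (auto intro!: derivative_eq_intros)
    from DERIV_chain2[OF DERIV_real_sqrt[OF radicand_pos[OF k2 a, of x]] this]
    show ?thesis unfolding rad_def by (simp add: field_simps)
  qed
  have U': "(U has_real_derivative (- (k2 * cos (2 * x)) + (U x)\<^sup>2) / ?r x) (at x)" for x
  proof -
    have "((\<lambda>x. - (k2 * (sin x * cos x))) has_real_derivative - (k2 * (cos x * cos x + - sin x * sin x))) (at x)"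
      by (intro DERIV_minus DERIV_cmult DERIV_mult DERIV_sin DERIV_cos)
    from DERIV_divide[OF this r'[of x]] r[of x]
    have "(U has_real_derivative (- (k2 * (cos x * cos x + - sin x * sin x)) * ?r x
       - (- (k2 * (sin x * cos x))) * (k2 * (sin x * cos x) / ?r x)) / (?r x * ?r x)) (at x)"
      unfolding U_def by simp
    moreover have cos2: "cos (2 * x) = cos x * cos x + - sin x * sin x"
      by (simp add: cos_double power2_eq_square)
    have "(- (k2 * (cos x * cos x + - sin x * sin x)) * ?r x
       - (- (k2 * (sin x * cos x))) * (k2 * (sin x * cos x) / ?r x)) / (?r x * ?r x)
       = (- (k2 * cos (2 * x)) + (U x)\<^sup>2) / ?r x"
      using r[of x] unfolding U_def cos2 by (simp add: field_simps power2_eq_square)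
    ultimately show ?thesis by (simp only:)
  qed
  define u where "u = (\<lambda>t. U (\<theta> t))"
  have u': "(u has_real_derivative k2 * cos (2 * \<theta> t) - (u t)\<^sup>2) (at t)" for t
  proof -
    have "(- (k2 * cos (2 * \<theta> t)) + (U (\<theta> t))\<^sup>2) / ?r (\<theta> t) * - ?r (\<theta> t)
        = k2 * cos (2 * \<theta> t) - (U (\<theta> t))\<^sup>2"
      using r[of "\<theta> t"] by simp
    then show ?thesis
      using DERIV_chain2[OF U' \<theta>', of t] unfolding u_def by (simp only:)
  qed
  have uc: "continuous_on S u" for S
    by (intro continuous_at_imp_continuous_on ballI DERIV_isCont[OF u'])
  have wu: "weak_deriv u (\<lambda>t. k2 * cos (2 * \<theta> t) - (u t)\<^sup>2)"
    by (rule weak_deriv_continuous_integrand)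
       (use u' in \<open>auto simp: has_real_derivative_iff_has_vector_derivative intro!: continuous_intros \<theta>c uc\<close>)
  have "\<theta> pi - \<theta> (- pi) = 2 * pi * of_int (- 1)"
    unfolding \<theta>_def by (rule phaseD(4)[OF phase_mzero[OF k2]])
  then have "\<theta> (- pi) = \<theta> pi + 2 * pi" by simp
  then have uper: "u pi = u (- pi)" unfolding u_def U_def by (simp add: rad_periodic)
  \<comment> \<open>The weak derivative of \<phi>^2 u; it integrates to zero because \<phi> and u
    are periodic, so subtracting it leaves the second variation unchanged.\<close>
  let ?X = "\<lambda>t. (h t * \<phi> t + \<phi> t * h t) * u t + (\<phi> t * \<phi> t) * (k2 * cos (2 * \<theta> t) - (u t)\<^sup>2)"
  have X: "weak_deriv (\<lambda>t. \<phi> t * \<phi> t * u t) ?X"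
    by (intro weak_deriv_mult h wu)
  have X0: "integral Ipi ?X = 0"
    using weak_deriv_integral[OF X] uper g0(3) by simp
  let ?L = "\<lambda>t. (h t)\<^sup>2 + k2 * (\<phi> t)\<^sup>2 * cos (2 * \<theta> t)"
  have L: "?L integrable_on Ipi"
    by (intro integrable_add h2 integrable_continuous_real continuous_intros \<theta>c weak_deriv_continuous[OF h])
  have "?L t - ?X t = (h t - u t * \<phi> t)\<^sup>2" for t
    by (simp add: power2_eq_square algebra_simps)
  then have "0 \<le> integral Ipi (\<lambda>t. ?L t - ?X t)"
    by (intro integral_nonneg integrable_diff L weak_derivD(2)[OF X]) simp
  also have "\<dots> = integral Ipi ?L"
    using integral_diff[OF L weak_derivD(2)[OF X]] X0 by simp
  finally show ?thesis unfolding h_def \<theta>_def .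
qed

section \<open>Local minimality of \<plusminus>n in the H1 topology\<close>

lemma weak_deriv_variation_le:
  fixes F :: "real \<Rightarrow> real"
  assumes F: "weak_deriv F f" and h: "h integrable_on Ipi" "\<And>t. t \<in> Ipi \<Longrightarrow> \<bar>f t\<bar> \<le> h t"
    and st: "s \<in> Ipi" "t \<in> Ipi"
  shows "\<bar>F t - F s\<bar> \<le> integral Ipi h"
proof -
  have *: "\<bar>F t - F s\<bar> \<le> integral Ipi h" if st: "s \<in> Ipi" "t \<in> Ipi" "s \<le> t" for s t
  proof -
    have sub: "{s..t} \<subseteq> Ipi" using st by auto
    have f: "f integrable_on {s..t}" by (rule integrable_on_subinterval[OF weak_derivD(2)[OF F] sub])
    have hi: "h integrable_on {s..t}" by (rule integrable_on_subinterval[OF h(1) sub])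
    have "integral {- pi..s} f + integral {s..t} f = integral {- pi..t} f"
      by (rule Henstock_Kurzweil_Integration.integral_combine) (use st weak_derivD(4)[OF F] in auto)
    then have "F t - F s = integral {s..t} f"
      using weak_derivD(3)[OF F st(1)] weak_derivD(3)[OF F st(2)] by linarith
    also have "norm \<dots> \<le> integral {s..t} h"
      by (rule integral_norm_bound_integral[OF f hi]) (use h(2) sub in auto)
    also have "\<dots> \<le> integral Ipi h"
      by (rule integral_subset_le[OF sub hi h(1)]) (use h(2) in \<open>force intro: order_trans[OF abs_ge_zero]\<close>)
    finally show ?thesis by simp
  qed
  show ?thesis
    using *[of s t] *[of t s] st by (cases "s \<le> t") (auto simp: abs_minus_commute)
qed

lemma norm_nvec_diff_sq: "(norm (nvec (t + x) - nvec (t + y)))\<^sup>2 = (1 - cos (x - y))\<^sup>2 + (sin (x - y))\<^sup>2"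
proof -
  have 1: "cos (t + x) * cos (t + y) + sin (t + x) * sin (t + y) = cos (x - y)"
    using cos_diff[of "t + x" "t + y"] by simp
  have "(norm (nvec (t + x) - nvec (t + y)))\<^sup>2
     = ((cos (t + x))\<^sup>2 + (sin (t + x))\<^sup>2) + ((cos (t + y))\<^sup>2 + (sin (t + y))\<^sup>2)
       - 2 * (cos (t + x) * cos (t + y) + sin (t + x) * sin (t + y))"
  proof -
    have "(a - b)\<^sup>2 + (c - d)\<^sup>2 + (0 - 0)\<^sup>2 = (a\<^sup>2 + c\<^sup>2) + (b\<^sup>2 + d\<^sup>2) - 2 * (a * b + c * d)"
      for a b c d :: real
      by (simp add: power2_eq_square algebra_simps)
    then show ?thesis unfolding norm_sq_real3 vector_minus_component nvec_nth .
  qed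
  also have "\<dots> = 2 - 2 * cos (x - y)"
    unfolding 1 sin_cos_squared_add2 by simp
  also have "\<dots> = (1 - cos (x - y))\<^sup>2 + (sin (x - y))\<^sup>2"
    unfolding power2_diff sin_squared_eq by simp
  finally show ?thesis .
qed

text \<open>In complex notation with s = x - y, rotating by -s turns (1 + g) e^(is) - 1 into (g + 1
  - cos s) + i sin s. The shape matches \<open>norm_nvec_diff_sq\<close>, with \<open>g\<close>
  added in the first square.\<close>

lemma norm_tauvec_diff_sq:
  "(norm ((1 + g) *\<^sub>R tauvec (t + x) - tauvec (t + y)))\<^sup>2
     = (g + (1 - cos (x - y)))\<^sup>2 + (sin (x - y))\<^sup>2"
proof -
  have 1: "cos (t + x) * cos (t + y) + sin (t + x) * sin (t + y) = cos (x - y)"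
    using cos_diff[of "t + x" "t + y"] by simp
  have "(norm ((1 + g) *\<^sub>R tauvec (t + x) - tauvec (t + y)))\<^sup>2
     = (1 + g)\<^sup>2 * ((cos (t + x))\<^sup>2 + (sin (t + x))\<^sup>2) + ((cos (t + y))\<^sup>2 + (sin (t + y))\<^sup>2)
       - 2 * (1 + g) * (cos (t + x) * cos (t + y) + sin (t + x) * sin (t + y))"
  proof -
    have "(e * - c - - d)\<^sup>2 + (e * a - b)\<^sup>2 + (e * 0 - 0)\<^sup>2
        = e\<^sup>2 * (a\<^sup>2 + c\<^sup>2) + (b\<^sup>2 + d\<^sup>2) - 2 * e * (a * b + c * d)" for a b c d e :: real
      by (simp add: power2_eq_square algebra_simps)
    then show ?thesis
      unfolding norm_sq_real3 vector_minus_component vector_scaleR_component real_scaleR_def tauvec_nth .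
  qed
  also have "\<dots> = (1 + g)\<^sup>2 + 1 - 2 * (1 + g) * cos (x - y)"
    unfolding 1 sin_cos_squared_add2 by simp
  also have "\<dots> = (g + (1 - cos (x - y)))\<^sup>2 + (sin (x - y))\<^sup>2"
    unfolding sin_squared_eq by (simp add: power2_eq_square algebra_simps)
  finally show ?thesis .
qed

text \<open>Smallness in $H^1$ gives uniform smallness, which forces the relative winding to vanish.\<close>

lemma local_min_nvec_const:
  assumes k2: "k2 > 0" and c: "sin c = 0"
  shows "local_min k2 (\<lambda>t. nvec (t + c))"
  unfolding local_min_def
\<comment> \<open>The radius 1/2 makes the squared distance E less than 1/4. Below, the squared
  pointwise distance D is at most 2 E < 1, which keeps the cosine of the phase difference
  positive.\<close>
proof (intro conjI exI[of _ "1/2"] allI impI)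
  let ?n = "\<lambda>t. nvec (t + c)"
  note pn = phase_nvec_const[OF c]
  show "H1S1 ?n" by (rule phase_H1S1[OF pn(1)])
  fix m assume m: "H1S1 m \<and> H1dist m ?n < 1/2"
  then obtain \<theta> g where p: "phase m \<theta> g (deg m - 1)" using H1S1_phase by blast
  define k where "k = deg m - 1"
  note p = p[folded k_def]
  define \<psi> where "\<psi> = (\<lambda>t. \<theta> t - c)"
  have w\<psi>: "weak_deriv \<psi> g"
    unfolding \<psi>_def using weak_deriv_diff[OF phaseD(1)[OF p] weak_deriv_const[of c]] by simp
  have \<psi>c: "continuous_on Ipi \<psi>" by (rule weak_deriv_continuous[OF w\<psi>])
  define D where "D = (\<lambda>t. (1 - cos (\<psi> t))\<^sup>2 + (sin (\<psi> t))\<^sup>2)"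
  define Q where "Q = (\<lambda>t. (g t + (1 - cos (\<psi> t)))\<^sup>2 + (sin (\<psi> t))\<^sup>2)"
  have D2: "D t = 2 - 2 * cos (\<psi> t)" for t
    unfolding D_def using sin_cos_squared_add2[of "\<psi> t"] by (simp add: power2_eq_square algebra_simps)
  have Di: "D integrable_on Ipi"
    unfolding D_def by (intro integrable_continuous_real continuous_intros \<psi>c)
  have "(\<lambda>t. (1 - cos (\<psi> t)) * g t) absolutely_integrable_on Ipi"
    by (intro absolutely_integrable_continuous_mult continuous_intros \<psi>c weak_derivD(1)[OF w\<psi>])
  then have cg: "(\<lambda>t. (1 - cos (\<psi> t)) * g t) integrable_on Ipi"
    by (simp add: absolutely_integrable_on_def)
  have "(\<lambda>t. (g t)\<^sup>2 + 2 * ((1 - cos (\<psi> t)) * g t) + D t) integrable_on Ipi"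
    by (intro integrable_add integrable_on_mult_right phaseD(2)[OF p] cg Di)
  moreover have "(\<lambda>t. (g t)\<^sup>2 + 2 * ((1 - cos (\<psi> t)) * g t) + D t) = Q"
    unfolding D_def Q_def by (auto simp: power2_eq_square algebra_simps)
  ultimately have Qi: "Q integrable_on Ipi" by simp
  have ID: "integral Ipi (\<lambda>t. (norm (m t - ?n t))\<^sup>2) = integral Ipi D"
    by (rule integral_cong) (simp add: phaseD(3)[OF p] norm_nvec_diff_sq D_def \<psi>_def)
  obtain N1 where N1: "negligible N1" "\<And>t. t \<in> Ipi - N1 \<Longrightarrow> wderiv m t = (1 + g t) *\<^sub>R tauvec (t + \<theta> t)"
    using phase_wderiv[OF p] by blast
  obtain N2 where N2: "negligible N2" "\<And>t. t \<in> Ipi - N2 \<Longrightarrow> wderiv ?n t = (1 + 0) *\<^sub>R tauvec (t + c)"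
    using phase_wderiv[OF pn(1)] by blast
  have IQ: "integral Ipi (\<lambda>t. (norm (wderiv m t - wderiv ?n t))\<^sup>2) = integral Ipi Q"
  proof (rule integral_spike[of "N1 \<union> N2"])
    show "Q t = (norm (wderiv m t - wderiv ?n t))\<^sup>2" if "t \<in> Ipi - (N1 \<union> N2)" for t
      using N1(2)[of t] N2(2)[of t] that norm_tauvec_diff_sq[of "g t" t "\<theta> t" c]
      by (simp add: Q_def \<psi>_def)
  qed (use N1 N2 in auto)
  define E where "E = integral Ipi D + integral Ipi Q"
  have nn: "0 \<le> integral Ipi D" "0 \<le> integral Ipi Q"
    by (intro integral_nonneg Di Qi; simp add: D_def Q_def)+
  have "sqrt E < 1 / 2" using m unfolding H1dist_def ID IQ E_def by simp
  then have "sqrt E < sqrt (1 / 4)" by (simp add: real_sqrt_divide)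
  then have E: "E < 1 / 4" by (simp only: real_sqrt_less_iff)
  have wD: "weak_deriv (\<lambda>t. 2 - 2 * cos (\<psi> t)) (\<lambda>t. (2 * sin (\<psi> t)) * g t)"
    by (rule weak_deriv_compose[OF w\<psi>]) (auto intro!: derivative_eq_intros continuous_intros)
  \<comment> \<open>The derivative of D is controlled by the density of the squared H1 distance
    itself: write g = G - C and estimate both products by squares. Hence D oscillates by at most
    E.\<close>
  have bound: "\<bar>(2 * sin (\<psi> t)) * g t\<bar> \<le> D t + Q t" for t
  proof -
    define S C G where "S = sin (\<psi> t)" and "C = 1 - cos (\<psi> t)" and "G = g t + C"
    have "2 * S * g t = 2 * S * G - 2 * S * C" by (simp add: G_def algebra_simps)
    moreover have "2 * S * G \<le> S\<^sup>2 + G\<^sup>2" "2 * S * C \<le> S\<^sup>2 + C\<^sup>2"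
      by (rule sum_squares_bound)+
    moreover have "- (2 * S * G) \<le> S\<^sup>2 + G\<^sup>2" "- (2 * S * C) \<le> S\<^sup>2 + C\<^sup>2"
      using sum_squares_bound[of "- S" G] sum_squares_bound[of "- S" C] by simp_all
    ultimately have "\<bar>2 * S * g t\<bar> \<le> (C\<^sup>2 + S\<^sup>2) + (G\<^sup>2 + S\<^sup>2)" by linarith
    then show ?thesis unfolding D_def Q_def S_def C_def G_def .
  qed
  have cos_pos: "cos (\<psi> t) > 0" if t: "t \<in> Ipi" for t
  proof -
    have var: "D t - E \<le> D s" if s: "s \<in> Ipi" for s
    proof -
      have "\<bar>(2 - 2 * cos (\<psi> t)) - (2 - 2 * cos (\<psi> s))\<bar> \<le> integral Ipi (\<lambda>t. D t + Q t)"
        by (rule weak_deriv_variation_le[OF wD integrable_add[OF Di Qi] bound s t])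
      then have "\<bar>D t - D s\<bar> \<le> E"
        unfolding integral_add[OF Di Qi] E_def[symmetric] D2[symmetric] .
      then show ?thesis by linarith
    qed
    \<comment> \<open>Averaging the oscillation bound over s: D cannot be large at one point without
      being large everywhere, against its small integral.\<close>
    have "integral Ipi (\<lambda>s. D t - E) \<le> integral Ipi D"
      by (rule integral_le[OF integrable_const_ivl Di]) (rule var)
    then have "2 * pi * (D t - E) \<le> E" using nn by (simp add: E_def)
    moreover have "D t - E \<le> 2 * pi * (D t - E)" if "D t - E \<ge> 0"
      using mult_right_mono[OF _ that, of 1 "2 * pi"] pi_ge_two by simp
    ultimately have "D t - E \<le> E \<or> D t - E < 0" by linarith
    moreover have "0 \<le> E" using nn by (simp add: E_def)
    ultimately have "D t < 1" using E by linarith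
    then show ?thesis unfolding D2 by simp
  qed
  \<comment> \<open>With positive cosine, arcsin (sin \<psi>) is a second lift of the same map. Its
    end values agree because sin \<psi> is periodic, so \<psi> has no winding and the degree-one
    energy bound applies.\<close>
  have "\<psi> pi - \<psi> (- pi) = arcsin (sin (\<psi> pi)) - arcsin (sin (\<psi> (- pi)))"
  proof (rule lift_difference_constant[OF \<psi>c])
    show "continuous_on Ipi (\<lambda>t. arcsin (sin (\<psi> t)))"
      by (intro continuous_on_arcsin continuous_intros \<psi>c) auto
    fix t assume "t \<in> Ipi"
    then have "cos (\<psi> t) > 0" by (rule cos_pos)
    have "cos (arcsin (sin (\<psi> t))) = sqrt (1 - (sin (\<psi> t))\<^sup>2)"
      by (rule cos_arcsin) auto
    also have "\<dots> = cos (\<psi> t)"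
      using \<open>cos (\<psi> t) > 0\<close> by (simp add: cos_squared_eq[symmetric])
    finally show "nvec (\<psi> t) = nvec (arcsin (sin (\<psi> t)))"
      by (simp add: nvec_def)
  qed
  moreover have per: "\<psi> pi - \<psi> (- pi) = 2 * pi * of_int k"
    using phaseD(4)[OF p] by (simp add: \<psi>_def)
  moreover have "sin (\<psi> pi) = sin (\<psi> (- pi))"
  proof -
    have "\<psi> pi = \<psi> (- pi) + 2 * pi * of_int k" using per by simp
    then show ?thesis using sin_cos_eq_iff by blast
  qed
  ultimately have "k = 0" by simp
  then show "Fen k2 ?n \<le> Fen k2 m"
    using Fen_phase_ge[OF k2 p] unfolding pn(2) by simp
qed simp

lemma local_min_nvec:
  assumes "k2 > 0"
  shows "local_min k2 nvec" "local_min k2 (\<lambda>t. - nvec t)"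
  using local_min_nvec_const[OF assms, of 0] local_min_nvec_const[OF assms, of pi]
  unfolding nvec_shift by simp_all

text \<open>The two certified values of \<open>excess\<close> lie on opposite sides of 4 pi, at
  2.31742 minus and plus 10^(-5), so the intermediate value theorem also yields the stated
  accuracy.\<close>

lemma threshold:
  obtains ks where "231741 / 100000 < ks" "ks < 231743 / 100000" "excess ks = 4 * pi"
proof -
  have "\<exists>x\<ge>231741 / 100000. x \<le> 231743 / 100000 \<and> excess x = 4 * pi"
    by (rule IVT'[where f=excess])
       (use excess_upper_231741 excess_lower_231743 in \<open>auto intro: continuous_on_subset[OF excess_continuous]\<close>)
  then obtain ks where ks: "231741 / 100000 \<le> ks" "ks \<le> 231743 / 100000" "excess ks = 4 * pi" by blast
  then have "ks \<noteq> 231741 / 100000" "ks \<noteq> 231743 / 100000"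
    using excess_upper_231741 excess_lower_231743 by (metis less_irrefl)+
  then show thesis using ks by (intro that[of ks]) linarith+
qed

theorem mainTheorem7:
  shows "(\<forall>k2>0. \<forall>m. global_min k2 m \<longrightarrow> deg m \<in> {0, 1}) \<and>
   (\<exists>ks. 2 \<le> ks \<and> ks \<le> 3 \<and>
     \<comment> \<open>(i)\<close>
     (\<forall>k2>ks. \<forall>m. global_min k2 m \<longrightarrow> deg m = 1) \<and>
     (\<forall>k2>0. (\<forall>m. min_in_deg k2 1 m \<longleftrightarrow>
                  H1S1 m \<and> ((\<forall>t\<in>Ipi. m t = nvec t) \<or> (\<forall>t\<in>Ipi. m t = - nvec t))) \<and>
              Fen k2 nvec = 2 * pi \<and> Fen k2 (\<lambda>t. - nvec t) = 2 * pi) \<and>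
     \<comment> \<open>(ii)\<close>
     (\<forall>k2. 0 < k2 \<and> k2 < ks \<longrightarrow> (\<forall>m. global_min k2 m \<longrightarrow> deg m = 0)) \<and>
     (\<forall>k2>0. (\<forall>m. min_in_deg k2 0 m \<longleftrightarrow>
                  H1S1 m \<and> (\<exists>b. \<forall>t\<in>Ipi. m t = mzero k2 b t)) \<and>
              (\<forall>m. min_in_deg k2 0 m \<longrightarrow>
                  Fen k2 m = - 2 * pi * (1 + (alpha k2)^2) + 2 * alpha k2 * Ek k2)) \<and>
     \<comment> \<open>(iii)\<close>
     (\<forall>k2>0. - 2 * pi * (alpha k2)^2 + 2 * alpha k2 * Ek k2 = 4 * pi \<longleftrightarrow> k2 = ks) \<and>
     \<bar>ks - 2.31742\<bar> \<le> 0.00001 \<and>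
     global_min ks nvec \<and> global_min ks (\<lambda>t. - nvec t) \<and>
     (\<forall>b. global_min ks (mzero ks b)) \<and>
     Fen ks nvec = 2 * pi \<and> (\<forall>b. Fen ks (mzero ks b) = 2 * pi) \<and>
     \<comment> \<open>(iv)\<close>
     (\<forall>k2>0. \<forall>b. \<forall>\<phi>::real \<Rightarrow> real. H1per \<phi> \<longrightarrow>
        integral Ipi (\<lambda>t. (wderiv \<phi> t)^2 +
             k2 * (\<phi> t)^2 * cos (2 * am k2 (- alpha k2 * t + b))) \<ge> 0) \<and>
     (\<forall>k2>0. local_min k2 nvec \<and> local_min k2 (\<lambda>t. - nvec t)))"
proof -
  obtain ks where ks: "231741 / 100000 < ks" "ks < 231743 / 100000" "excess ks = 4 * pi"
    by (rule threshold)
  have ks0: "ks > 0" using ks(1) by simp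
  have gt: "4 * pi < excess k2" if "k2 > ks" for k2
    using excess_strict_mono[OF ks0 that] ks(3) by simp
  have lt: "excess k2 < 4 * pi" if "0 < k2" "k2 < ks" for k2
    using excess_strict_mono[OF that] ks(3) by simp
  have iff: "- 2 * pi * (alpha k2)\<^sup>2 + 2 * alpha k2 * Ek k2 = 4 * pi \<longleftrightarrow> k2 = ks" if "k2 > 0" for k2
    unfolding excess_alpha_Ek[OF that, symmetric]
    using gt[of k2] lt[OF that] ks(3) by (cases k2 ks rule: linorder_cases) auto
  have e0: "Fen k2 m = - 2 * pi * (1 + (alpha k2)\<^sup>2) + 2 * alpha k2 * Ek k2"
    if "k2 > 0" "min_in_deg k2 0 m" for k2 m
    unfolding min_in_deg_zero_Fen[OF that] excess_alpha_Ek[OF that(1)] by (simp add: algebra_simps)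
  have gm: "global_min ks m" if "H1S1 m" "Fen ks m = 2 * pi" for m
    unfolding global_min_def using that Fen_ge_at_threshold[OF ks0 ks(3)] by simp
  have mz: "Fen ks (mzero ks b) = 2 * pi" for b
    using mzero_energy(3)[OF ks0, of b] ks(3) by simp
  show ?thesis
  proof (intro conjI exI[of _ ks] allI impI)
    show "2 \<le> ks" "ks \<le> 3" using ks(1,2) by simp_all
    show "\<bar>ks - 2.31742\<bar> \<le> 0.00001" unfolding abs_le_iff using ks(1,2) by simp
    show "deg m \<in> {0, 1}" if "k2 > 0" "global_min k2 m" for k2 m
      by (rule global_min_deg(1)[OF that])
    show "deg m = 1" if "k2 > ks" "global_min k2 m" for k2 m
      using global_min_deg(2)[OF _ that(2) gt[OF that(1)]] ks0 that(1) by simp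
    show "deg m = 0" if "0 < k2 \<and> k2 < ks" "global_min k2 m" for k2 m
      using global_min_deg(3)[OF _ that(2) lt] that(1) by simp
    show "0 \<le> integral Ipi (\<lambda>t. (wderiv \<phi> t)\<^sup>2 + k2 * (\<phi> t)\<^sup>2 * cos (2 * am k2 (- alpha k2 * t + b)))"
      if "k2 > 0" "H1per \<phi>" for k2 b and \<phi> :: "real \<Rightarrow> real"
      by (rule second_variation_nonneg[OF that])
    show "- 2 * pi * (alpha k2)\<^sup>2 + 2 * alpha k2 * Ek k2 = 4 * pi \<longleftrightarrow> k2 = ks" if "k2 > 0" for k2
      by (rule iff[OF that])
  qed (simp_all add: min_in_deg_one_iff min_in_deg_zero_iff[symmetric] e0 Fen_nvec gm mz H1S1_nvec
      mzero_energy(1)[OF ks0] local_min_nvec)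
qed

end
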